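(* The NC-fcr reduction $\le^{NC}_{fcr}$ on decision problems is transitive: for all decision problems $L_1,L_2,L_3\subseteq\Sigma^*$, if $L_1\le^{NC}_{fcr}L_2$ and $L_2\le^{NC}_{fcr}L_3$, then $L_1\le^{NC}_{fcr}L_3$.
   Context: $\Sigma$ is a finite alphabet; a decision problem is a language $L\subseteq\Sigma^*$. An NC function is a function computable on a PRAM in $\log^{O(1)} n$ time with $n^{O(1)}$ processors. A factorization with constant redundancy (cr-factorization) of $L$ is a tuple $\Upsilon=(\pi_1,\pi_2,\rho,c)$ with $\pi_1,\pi_2,\rho$ NC functions and $c$ a constant such that for all $x\in L$: $\rho(\pi_1(x),\pi_2(x))=x$, $|\pi_1(x)|+|\pi_2(x)|\le|x|+c$, and $|\pi_2(x)|\in O(\mathrm{polylog}(|\pi_1(x)|))$. Its language of pairs is $S_{(L,\Upsilon)}=\{\langle\pi_1(x),\pi_2(x)\rangle : x\in L\}$. We write $L_1\le^{NC}_{fcr}L_2$ if there exist a cr-factorization $\Upsilon_1$ of $L_1$, a cr-factorization $\Upsilon_2$ of $L_2$, and NC functions $\alpha,\beta$ such that for all $D,Q\in\Sigma^*$: $\langle D,Q\rangle\in S_{(L_1,\Upsilon_1)}$ iff $\langle\alpha(D),\beta(Q)\rangle\in S_{(L_2,\Upsilon_2)}$. *)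

theory Defs
  imports Complex_Main "HOL-Library.Countable"
begin

section \<open>A parallel random access machine\<close>

text \<open>
  Synchronous PRAM in the style of Fortune and Wyllie: every processor runs the same finite
  program, but has its own program counter and its own registers. Arithmetic is restricted to
  addition and truncated subtraction, so that in polylogarithmic time only numbers of
  polylogarithmic bit length arise; unit-cost multiplication would go beyond NC.
  The shared memory is organised in arrays: a cell is addressed by an array name, which is fixed
  in the program text (so that a program uses finitely many arrays), and an index, which
  is computed at run time.
\<close>

datatype instr =
    Const nat nat       \<comment> \<open>\<open>Const r c\<close>: register \<open>r\<close> becomes \<open>c\<close>\<close>
  | Pid nat             \<comment> \<open>\<open>Pid r\<close>: register \<open>r\<close> becomes the index of the executing processor\<close>
  | Add nat nat nat     \<comment> \<open>\<open>Add r s t\<close>: register \<open>r\<close> becomes \<open>s + t\<close>\<close>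
  | Sub nat nat nat     \<comment> \<open>\<open>Sub r s t\<close>: register \<open>r\<close> becomes \<open>s - t\<close>, truncated at \<open>0\<close>\<close>
  | Load nat nat nat    \<comment> \<open>\<open>Load r b s\<close>: register \<open>r\<close> becomes cell \<open>s\<close> of array \<open>b\<close>\<close>
  | Store nat nat nat   \<comment> \<open>\<open>Store b s r\<close>: cell \<open>s\<close> of array \<open>b\<close> becomes register \<open>r\<close>\<close>
  | Jz nat nat          \<comment> \<open>\<open>Jz r l\<close>: go to instruction \<open>l\<close> if register \<open>r\<close> is \<open>0\<close>\<close>

type_synonym memory = "nat \<Rightarrow> nat \<Rightarrow> nat"

record pram_state =
  mem :: memory
  pc  :: "nat \<Rightarrow> nat"
  reg :: "nat \<Rightarrow> nat \<Rightarrow> nat"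

fun next_pc :: "instr \<Rightarrow> (nat \<Rightarrow> nat) \<Rightarrow> nat \<Rightarrow> nat" where
  "next_pc (Jz r l) R p = (if R r = 0 then l else Suc p)"
| "next_pc _ R p = Suc p"

fun next_reg :: "instr \<Rightarrow> nat \<Rightarrow> memory \<Rightarrow> (nat \<Rightarrow> nat) \<Rightarrow> (nat \<Rightarrow> nat)" where
  "next_reg (Const r c) i M R = R(r := c)"
| "next_reg (Pid r) i M R = R(r := i)"
| "next_reg (Add r s t) i M R = R(r := R s + R t)"
| "next_reg (Sub r s t) i M R = R(r := R s - R t)"
| "next_reg (Load r b s) i M R = R(r := M b (R s))"
| "next_reg _ i M R = R"

fun write_req :: "instr \<Rightarrow> (nat \<Rightarrow> nat) \<Rightarrow> (nat \<times> nat \<times> nat) option" where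
  "write_req (Store b s r) R = Some (b, R s, R r)"
| "write_req _ R = None"

text \<open>A processor has halted once its program counter has left the program.\<close>

definition halted :: "instr list \<Rightarrow> pram_state \<Rightarrow> nat \<Rightarrow> bool" where
  "halted prog s i \<longleftrightarrow> length prog \<le> pc s i"

definition proc_write :: "instr list \<Rightarrow> pram_state \<Rightarrow> nat \<Rightarrow> (nat \<times> nat \<times> nat) option" where
  "proc_write prog s i = (if halted prog s i then None else write_req (prog ! pc s i) (reg s i))"

definition writes_to :: "instr list \<Rightarrow> pram_state \<Rightarrow> nat \<Rightarrow> nat \<Rightarrow> nat \<Rightarrow> bool" where
  "writes_to prog s b a i \<longleftrightarrow> (\<exists>v. proc_write prog s i = Some (b, a, v))"

text \<open>
  One synchronous step of the processors \<open>0, \<dots>, P - 1\<close>: all reads precede all writes, and among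
  concurrent writes to one cell the processor with the least index wins (priority CRCW; the usual
  conflict rules all yield the same class NC).
\<close>

definition pram_step :: "instr list \<Rightarrow> nat \<Rightarrow> pram_state \<Rightarrow> pram_state" where
  "pram_step prog P s =
     \<lparr> mem = (\<lambda>b a. if \<exists>i<P. writes_to prog s b a i
                    then snd (snd (the (proc_write prog s (LEAST i. i < P \<and> writes_to prog s b a i))))
                    else mem s b a),
       pc = (\<lambda>i. if i < P \<and> \<not> halted prog s i
                 then next_pc (prog ! pc s i) (reg s i) (pc s i) else pc s i),
       reg = (\<lambda>i. if i < P \<and> \<not> halted prog s i
                  then next_reg (prog ! pc s i) i (mem s) (reg s i) else reg s i) \<rparr>"

text \<open>
  A word is stored in an array with one symbol per cell, followed by zeros. Symbols have nonzero
  codes, so the length of the word can be read off. The choice of injective numbering of the finite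
  alphabet does not affect the class of computable functions.
\<close>

definition word_cells :: "'a::finite list \<Rightarrow> nat \<Rightarrow> nat" where
  "word_cells w j = (if j < length w then Suc (to_nat (w ! j)) else 0)"

text \<open>Array \<open>0\<close> is for the output, arrays \<open>1, 2, \<dots>\<close> initially hold the input words.\<close>

definition init_state :: "'a::finite list list \<Rightarrow> pram_state" where
  "init_state ws =
     \<lparr> mem = (\<lambda>b a. if 1 \<le> b \<and> b \<le> length ws then word_cells (ws ! (b - 1)) a else 0),
       pc = (\<lambda>i. 0), reg = (\<lambda>i r. 0) \<rparr>"

definition pram_outputs_in ::
  "instr list \<Rightarrow> nat \<Rightarrow> 'a::finite list list \<Rightarrow> nat \<Rightarrow> 'a list \<Rightarrow> bool" where
  "pram_outputs_in prog P ws t w \<longleftrightarrow>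
     (let s = (pram_step prog P ^^ t) (init_state ws)
      in (\<forall>i<P. halted prog s i) \<and> mem s 0 = word_cells w)"


section \<open>NC functions\<close>

text \<open>The shift by \<open>2\<close> only keeps the logarithm at least \<open>1\<close> for small arguments.\<close>

definition polylog :: "nat \<Rightarrow> nat \<Rightarrow> real" where
  "polylog k n = log 2 (real n + 2) ^ k"

text \<open>
  The map \<open>inp\<close> presents an argument as a tuple of words, whose total length is the input size \<open>n\<close>.
  One program handles all inputs. It must work, within the same time bound, for every
  sufficiently large number \<open>P\<close> of processors, from \<open>C * (n + 1) ^ k\<close> on. This is no restriction,
  as processors with larger indices can compute that bound and idle; it avoids that
  non-uniform information is passed to the program through the number of processors.
\<close>

definition NC_computable :: "('x \<Rightarrow> 'a::finite list list) \<Rightarrow> ('x \<Rightarrow> 'a list) \<Rightarrow> bool" where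
  "NC_computable inp f \<longleftrightarrow>
     (\<exists>prog C k. \<forall>x. let n = sum_list (map length (inp x)) in
        \<forall>P \<ge> C * (n + 1) ^ k.
          \<exists>t. real t \<le> real C * polylog k n \<and> pram_outputs_in prog P (inp x) t (f x))"

definition NC_fun :: "('a::finite list \<Rightarrow> 'a list) \<Rightarrow> bool" where
  "NC_fun f \<longleftrightarrow> NC_computable (\<lambda>x. [x]) f"

definition NC_fun2 :: "('a::finite list \<Rightarrow> 'a list \<Rightarrow> 'a list) \<Rightarrow> bool" where
  "NC_fun2 g \<longleftrightarrow> NC_computable (\<lambda>(x, y). [x, y]) (\<lambda>(x, y). g x y)"


section \<open>Factorizations with constant redundancy and the reduction\<close>

type_synonym 'a factorization =
  "('a list \<Rightarrow> 'a list) \<times> ('a list \<Rightarrow> 'a list) \<times> ('a list \<Rightarrow> 'a list \<Rightarrow> 'a list) \<times> nat"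

definition cr_factorization :: "'a::finite list set \<Rightarrow> 'a factorization \<Rightarrow> bool" where
  "cr_factorization L \<Upsilon> \<longleftrightarrow>
     (case \<Upsilon> of (\<pi>1, \<pi>2, \<rho>, c) \<Rightarrow>
        NC_fun \<pi>1 \<and> NC_fun \<pi>2 \<and> NC_fun2 \<rho> \<and>
        (\<forall>x\<in>L. \<rho> (\<pi>1 x) (\<pi>2 x) = x) \<and>
        (\<forall>x\<in>L. length (\<pi>1 x) + length (\<pi>2 x) \<le> length x + c) \<and>
        (\<exists>(C::nat) k. \<forall>x\<in>L. real (length (\<pi>2 x)) \<le> real C * polylog k (length (\<pi>1 x))))"

definition pair_language :: "'a::finite list set \<Rightarrow> 'a factorization \<Rightarrow> ('a list \<times> 'a list) set" where
  "pair_language L \<Upsilon> = (case \<Upsilon> of (\<pi>1, \<pi>2, \<rho>, c) \<Rightarrow> {(\<pi>1 x, \<pi>2 x) | x. x \<in> L})"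

definition NC_fcr_reducible ::
  "'a::finite list set \<Rightarrow> 'a list set \<Rightarrow> bool"  (infix \<open>\<le>\<^sub>f\<^sub>c\<^sub>r\<close> 50) where
  "L1 \<le>\<^sub>f\<^sub>c\<^sub>r L2 \<longleftrightarrow>
     (\<exists>\<Upsilon>1 \<Upsilon>2 \<alpha> \<beta>. cr_factorization L1 \<Upsilon>1 \<and> cr_factorization L2 \<Upsilon>2 \<and> NC_fun \<alpha> \<and> NC_fun \<beta> \<and>
        (\<forall>D Q. (D, Q) \<in> pair_language L1 \<Upsilon>1 \<longleftrightarrow> (\<alpha> D, \<beta> Q) \<in> pair_language L2 \<Upsilon>2))"

end

theory Submission
  imports Defs "HOL-Library.Nat_Bijection"
begin

text \<open>
  If \<open>L1\<close> reduces to \<open>L2\<close>, then membership of \<open>x\<close> in \<open>L1\<close> can be decided from one candidate word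
  \<open>y x\<close>: factor \<open>x\<close>, apply \<open>\<alpha>\<close> and \<open>\<beta>\<close>, and recombine with the restoring function of \<open>L2\<close>. Checking
  that both restoring functions invert the factorizations at these points makes the equivalence
  exact. So a reduction is a many-one reduction that may reject, and these compose. Conversely such
  a reduction becomes an fcr-reduction for the factorization \<open>x \<mapsto> (x, [])\<close> of \<open>L1\<close> and the
  factorization \<open>z \<mapsto> (a # z, [])\<close> of \<open>L3\<close>, where the redundant symbol \<open>a\<close> leaves \<open>[]\<close> free for
  rejection.

  The work lies in composing PRAM programs. Processors halt at different times, so each subprogram
  is run in rounds of constant length with a shared flag that tells whether some processor is
  still active; this lets all processors leave the subprogram simultaneously.
\<close>

section \<open>Conflict resolution among concurrent writes\<close>

section \<open>Parallel writes and lockstep execution\<close>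

text \<open>The memory component of \<open>pram_step\<close> with the write requests as a parameter,
  so that conflicts can be analysed apart from programs and states.\<close>

definition par_write ::
  "nat \<Rightarrow> (nat \<Rightarrow> (nat \<times> nat \<times> nat) option) \<Rightarrow> memory \<Rightarrow> memory" where
  "par_write P w M = (\<lambda>b a. if \<exists>i<P. \<exists>v. w i = Some (b, a, v)
     then snd (snd (the (w (LEAST i. i < P \<and> (\<exists>v. w i = Some (b, a, v))))))
     else M b a)"

lemma mem_pram_step: "mem (pram_step q P s) = par_write P (proc_write q s) (mem s)"
  unfolding pram_step_def par_write_def writes_to_def by simp

text \<open>A least writer exists, and agreement of all writers makes its identity
  irrelevant.\<close>

lemma par_write_eqI:
  assumes "i < P" "w i = Some (b, a, v)"
    and "\<And>j v'. j < P \<Longrightarrow> w j = Some (b, a, v') \<Longrightarrow> v' = v"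
  shows "par_write P w M b a = v"
proof -
  let ?Q = "\<lambda>i. i < P \<and> (\<exists>v. w i = Some (b, a, v))"
  have ex: "\<exists>i. ?Q i" using assms(1,2) by blast
  from LeastI_ex[OF this] have "w (LEAST i. ?Q i) = Some (b, a, v)" using assms(3) by blast
  then show ?thesis using ex by (simp add: par_write_def)
qed

lemma par_write_other:
  "(\<And>i v. i < P \<Longrightarrow> w i \<noteq> Some (b, a, v)) \<Longrightarrow> par_write P w M b a = M b a"
  by (auto simp: par_write_def)

text \<open>Requests of processors from \<open>P\<close> on do not matter, so \<open>w\<close> may
  be simplified with facts that are known only for \<open>i < P\<close>.\<close>

lemma par_write_cong:
  assumes "\<And>i. i < P \<Longrightarrow> w i = w' i"
  shows "par_write P w M = par_write P w' M"
proof (intro ext)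
  fix b a
  have eq: "(\<lambda>i. i < P \<and> (\<exists>v. w i = Some (b, a, v))) = (\<lambda>i. i < P \<and> (\<exists>v. w' i = Some (b, a, v)))"
    using assms by auto
  show "par_write P w M b a = par_write P w' M b a"
  proof (cases "\<exists>i<P. \<exists>v. w' i = Some (b, a, v)")
    case True
    then have "(LEAST i. i < P \<and> (\<exists>v. w' i = Some (b, a, v))) < P"
      using LeastI_ex[of "\<lambda>i. i < P \<and> (\<exists>v. w' i = Some (b, a, v))"] by blast
    moreover have "\<exists>i<P. \<exists>v. w i = Some (b, a, v)" using True assms by auto
    ultimately show ?thesis using True assms by (simp add: par_write_def eq)
  next
    case False
    then have "par_write P w M b a = M b a" "par_write P w' M b a = M b a"
      using assms by (auto intro!: par_write_other)
    then show ?thesis by simp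
  qed
qed

text \<open>Serves for the barrier flag: all requests coincide, so only the existence of a writer
  counts.\<close>

lemma par_write_same:
  assumes "\<And>i. i < P \<Longrightarrow> w i = None \<or> w i = Some (b, a, v)"
  shows "par_write P w M =
    (if \<exists>i<P. w i \<noteq> None then M(b := (M b)(a := v)) else M)"
proof (cases "\<exists>i<P. w i \<noteq> None")
  case True
  then obtain i where "i < P" "w i \<noteq> None" by blast
  with assms[of i] have i: "i < P" "w i = Some (b, a, v)" by simp_all
  have "par_write P w M b' a' = (M(b := (M b)(a := v))) b' a'" for b' a'
  proof (cases "b' = b \<and> a' = a")
    case True
    have "par_write P w M b a = v"
    proof (rule par_write_eqI)
      fix j v' assume "j < P" "w j = Some (b, a, v')"
      then show "v' = v" using assms[of j] by simp
    qed (rule i)+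
    then show ?thesis using True by simp
  next
    case False
    have "par_write P w M b' a' = M b' a'"
    proof (rule par_write_other)
      fix j v' assume "j < P"
      then show "w j \<noteq> Some (b', a', v')" using assms[of j] False by auto
    qed
    then show ?thesis using False by auto
  qed
  then have "par_write P w M = M(b := (M b)(a := v))" by (intro ext)
  then show ?thesis using True by simp
next
  case False
  then show ?thesis by (auto intro!: ext par_write_other)
qed

lemma par_write_None [simp]: "par_write P (\<lambda>i. None) M = M"
  by (simp add: par_write_def)

lemma par_write_const:
  "par_write P (\<lambda>i. Some (b, d i, v)) M =
     M(b := (\<lambda>a. if \<exists>i<P. d i = a then v else M b a))"
proof (intro ext)
  fix b' a'
  show "par_write P (\<lambda>i. Some (b, d i, v)) M b' a' =
     (M(b := (\<lambda>a. if \<exists>i<P. d i = a then v else M b a))) b' a'"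
  proof (cases "b' = b \<and> (\<exists>i<P. d i = a')")
    case True
    then obtain i where "i < P" "d i = a'" by blast
    then show ?thesis using True par_write_eqI[of i P "\<lambda>i. Some (b, d i, v)" b a' v M] by auto
  qed (auto simp: par_write_def)
qed

lemma par_write_index:
  "par_write P (\<lambda>i. Some (b, i, f i)) M = M(b := (\<lambda>a. if a < P then f a else M b a))"
proof (intro ext)
  fix b' a'
  show "par_write P (\<lambda>i. Some (b, i, f i)) M b' a' =
     (M(b := (\<lambda>a. if a < P then f a else M b a))) b' a'"
  proof (cases "b' = b \<and> a' < P")
    case True
    then show ?thesis
      using par_write_eqI[of a' P "\<lambda>i. Some (b, i, f i)" b a' "f a'" M] by auto
  qed (auto simp: par_write_def)
qed

text \<open>Injectivity keeps different arrays apart, so a renamed cell has the same writers as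
  before and in particular the same least one.\<close>

lemma par_write_rename:
  assumes "inj \<sigma>"
  shows "par_write P (\<lambda>i. map_option (\<lambda>(b, a, v). (\<sigma> b, a, v)) (w i)) M (\<sigma> b) =
    par_write P w (\<lambda>b. M (\<sigma> b)) b"
proof
  fix a
  have eq: "(\<exists>v. map_option (\<lambda>(b, a, v). (\<sigma> b, a, v)) (w i) = Some (\<sigma> b, a, v)) \<longleftrightarrow>
      (\<exists>v. w i = Some (b, a, v))" for i
    using assms by (cases "w i") (auto dest: injD)
  show "par_write P (\<lambda>i. map_option (\<lambda>(b, a, v). (\<sigma> b, a, v)) (w i)) M (\<sigma> b) a =
    par_write P w (\<lambda>b. M (\<sigma> b)) b a"
  proof (cases "\<exists>i<P. \<exists>v. w i = Some (b, a, v)")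
    case True
    let ?l = "LEAST i. i < P \<and> (\<exists>v. w i = Some (b, a, v))"
    from True have "\<exists>v. w ?l = Some (b, a, v)"
      using LeastI_ex[of "\<lambda>i. i < P \<and> (\<exists>v. w i = Some (b, a, v))"] by blast
    moreover have "\<exists>i<P. \<exists>v. map_option (\<lambda>(b, a, v). (\<sigma> b, a, v)) (w i) = Some (\<sigma> b, a, v)"
      using True unfolding eq .
    ultimately show ?thesis using True unfolding par_write_def eq by auto
  next
    case False
    then have "\<And>i v. i < P \<Longrightarrow>
        map_option (\<lambda>(b, a, v). (\<sigma> b, a, v)) (w i) \<noteq> Some (\<sigma> b, a, v)"
      using eq by blast
    then show ?thesis using False
      by (subst (1 2) par_write_other) blast+
  qed
qed

lemma par_write_rename_other:
  "c \<notin> range \<sigma> \<Longrightarrow> par_write P (\<lambda>i. map_option (\<lambda>(b, a, v). (\<sigma> b, a, v)) (w i)) M c = M c"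
  by (rule ext, rule par_write_other) auto

section \<open>Execution of code without jumps\<close>

lemma pram_step_instrs:
  assumes "\<forall>i<P. pc s i < length q \<and> q ! pc s i = I i"
  shows "i < P \<Longrightarrow> pc (pram_step q P s) i = next_pc (I i) (reg s i) (pc s i)"
    and "i < P \<Longrightarrow> reg (pram_step q P s) i = next_reg (I i) i (mem s) (reg s i)"
    and "mem (pram_step q P s) = par_write P (\<lambda>i. write_req (I i) (reg s i)) (mem s)"
proof -
  show "i < P \<Longrightarrow> pc (pram_step q P s) i = next_pc (I i) (reg s i) (pc s i)"
    "i < P \<Longrightarrow> reg (pram_step q P s) i = next_reg (I i) i (mem s) (reg s i)"
    using assms by (simp_all add: pram_step_def halted_def not_le)
  show "mem (pram_step q P s) = par_write P (\<lambda>i. write_req (I i) (reg s i)) (mem s)"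
    unfolding mem_pram_step
    by (rule par_write_cong) (use assms in \<open>auto simp: proc_write_def halted_def dest: leD\<close>)
qed

lemma pram_step_halted:
  assumes "\<forall>i<P. halted q s i"
  shows "pram_step q P s = s"
proof -
  have "mem (pram_step q P s) = mem s"
    unfolding mem_pram_step using assms
    by (intro ext par_write_other) (simp add: proc_write_def)
  moreover have "pc (pram_step q P s) = pc s" "reg (pram_step q P s) = reg s"
    using assms by (force simp: pram_step_def)+
  ultimately show ?thesis by simp
qed

lemma pram_steps_halted:
  "\<forall>i<P. halted q s i \<Longrightarrow> (pram_step q P ^^ t) s = s"
  by (induction t) (simp_all add: pram_step_halted)

text \<open>A symbolic evaluator for jump-free code that all processors execute at the same
  position: program counters disappear and the simplifier can compute the outcome.\<close>

fun lockstep :: "nat \<Rightarrow> instr list \<Rightarrow> memory \<times> (nat \<Rightarrow> nat \<Rightarrow> nat) \<Rightarrow> memory \<times> (nat \<Rightarrow> nat \<Rightarrow> nat)" where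
  "lockstep P [] (M, R) = (M, R)"
| "lockstep P (I # c) (M, R) =
     lockstep P c (par_write P (\<lambda>i. write_req I (R i)) M, \<lambda>i. next_reg I i M (R i))"

fun is_jump :: "instr \<Rightarrow> bool" where
  "is_jump (Jz r l) = True"
| "is_jump _ = False"

lemma next_pc_not_jump: "\<not> is_jump I \<Longrightarrow> next_pc I R p = Suc p"
  by (cases I) auto

definition placed :: "instr list \<Rightarrow> nat \<Rightarrow> instr list \<Rightarrow> bool" where
  "placed q p c \<longleftrightarrow> p + length c \<le> length q \<and> (\<forall>k<length c. q ! (p + k) = c ! k)"

lemma placed_Nil [simp]: "placed q p [] \<longleftrightarrow> p \<le> length q"
  by (simp add: placed_def)

lemma placed_append:
  "placed q p (c @ d) \<longleftrightarrow> placed q p c \<and> placed q (p + length c) d"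
proof
  assume h: "placed q p (c @ d)"
  have "q ! (p + length c + k) = d ! k" if "k < length d" for k
  proof -
    have "q ! (p + (length c + k)) = (c @ d) ! (length c + k)"
      using h that unfolding placed_def length_append by simp
    then show ?thesis by (simp add: add.assoc)
  qed
  moreover have "q ! (p + k) = c ! k" if "k < length c" for k
    using h that by (auto simp: placed_def nth_append)
  ultimately show "placed q p c \<and> placed q (p + length c) d"
    using h by (auto simp: placed_def)
next
  assume h: "placed q p c \<and> placed q (p + length c) d"
  have "q ! (p + k) = (c @ d) ! k" if "k < length c + length d" for k
  proof (cases "k < length c")
    case False
    then have "k - length c < length d" "p + k = p + length c + (k - length c)" using that by auto
    then have "q ! (p + k) = d ! (k - length c)" using h unfolding placed_def by metis
    then show ?thesis using False by (simp add: nth_append)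
  qed (use h in \<open>auto simp: placed_def nth_append\<close>)
  then show "placed q p (c @ d)" using h by (auto simp: placed_def)
qed

lemma placed_Cons: "placed q p (I # c) \<longleftrightarrow> p < length q \<and> q ! p = I \<and> placed q (Suc p) c"
proof -
  have "placed q p [I] \<longleftrightarrow> p < length q \<and> q ! p = I"
    by (simp add: placed_def Suc_le_eq)
  then show ?thesis using placed_append[of q p "[I]" c] by simp
qed

lemma placed_self [simp]: "placed q 0 q"
  by (simp add: placed_def)

text \<open>Without jumps all counters stay equal. \<open>lockstep\<close> updates the registers of
  every index, \<open>pram_step\<close> only those below \<open>P\<close>; hence \<open>R\<close>
  has to agree with the state only there.\<close>

lemma lockstep_run:
  assumes "placed q p c" "\<forall>i<P. pc s i = p" "\<forall>I\<in>set c. \<not> is_jump I"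
    and "\<forall>i<P. reg s i = R i"
  defines "s' \<equiv> (pram_step q P ^^ length c) s"
  shows "(\<forall>i<P. pc s' i = p + length c) \<and> mem s' = fst (lockstep P c (mem s, R)) \<and>
    (\<forall>i<P. reg s' i = snd (lockstep P c (mem s, R)) i)"
  using assms(1-4) unfolding s'_def
proof (induction c arbitrary: p s R)
  case (Cons I c)
  let ?s = "pram_step q P s"
  have I: "\<forall>i<P. pc s i < length q \<and> q ! pc s i = I"
    using Cons.prems by (auto simp: placed_Cons)
  note st = pram_step_instrs[where I = "\<lambda>_. I", OF I]
  have mem: "mem ?s = par_write P (\<lambda>i. write_req I (R i)) (mem s)"
    unfolding st(3) by (rule par_write_cong) (use Cons.prems in auto)
  have "\<forall>i<P. reg ?s i = (\<lambda>i. next_reg I i (mem s) (R i)) i" using st(2) Cons.prems by simp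
  moreover have "\<forall>i<P. pc ?s i = Suc p"
    using st(1) Cons.prems next_pc_not_jump[of I] by simp
  moreover have "placed q (Suc p) c" "\<forall>I\<in>set c. \<not> is_jump I"
    using Cons.prems by (simp_all add: placed_Cons)
  moreover have "(pram_step q P ^^ length (I # c)) s = (pram_step q P ^^ length c) ?s"
    by (simp add: funpow_swap1)
  ultimately show ?case
    using Cons.IH[of "Suc p" ?s "\<lambda>i. next_reg I i (mem s) (R i)"] mem by simp
qed simp

section \<open>Hoare triples with time bounds\<close>

section \<open>Code fragments\<close>

text \<open>All processors enter the fragment together and leave it together, right behind its last
  instruction. The code \<open>c\<close> depends on its position because jump targets are
  absolute.\<close>

definition triple ::
  "nat \<Rightarrow> nat \<Rightarrow> (nat \<Rightarrow> instr list) \<Rightarrow> (pram_state \<Rightarrow> bool) \<Rightarrow> (pram_state \<Rightarrow> bool) \<Rightarrow> bool" where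
  "triple P T c A B \<longleftrightarrow> (\<forall>q p s. placed q p (c p) \<longrightarrow> (\<forall>i<P. pc s i = p) \<longrightarrow> A s \<longrightarrow>
     (\<exists>t\<le>T. (\<forall>i<P. pc ((pram_step q P ^^ t) s) i = p + length (c p)) \<and>
            B ((pram_step q P ^^ t) s)))"

definition seq :: "(nat \<Rightarrow> instr list) \<Rightarrow> (nat \<Rightarrow> instr list) \<Rightarrow> nat \<Rightarrow> instr list" where
  "seq c d p = c p @ d (p + length (c p))"

lemma triple_seq:
  assumes "triple P T c A B" "triple P T' d B C"
  shows "triple P (T + T') (seq c d) A C"
  unfolding triple_def
proof (intro allI impI)
  fix q p s
  assume pl: "placed q p (seq c d p)" and "\<forall>i<P. pc s i = p" "A s"
  then obtain t where t: "t \<le> T" "\<forall>i<P. pc ((pram_step q P ^^ t) s) i = p + length (c p)"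
    "B ((pram_step q P ^^ t) s)"
    using assms(1) unfolding triple_def seq_def placed_append by blast
  then obtain t' where t': "t' \<le> T'"
    "\<forall>i<P. pc ((pram_step q P ^^ t') ((pram_step q P ^^ t) s)) i =
       p + length (c p) + length (d (p + length (c p)))"
    "C ((pram_step q P ^^ t') ((pram_step q P ^^ t) s))"
    using assms(2) pl unfolding triple_def seq_def placed_append by blast
  show "\<exists>u\<le>T + T'. (\<forall>i<P. pc ((pram_step q P ^^ u) s) i = p + length (seq c d p)) \<and>
      C ((pram_step q P ^^ u) s)"
    by (rule exI[of _ "t' + t"]) (use t t' in \<open>auto simp: funpow_add seq_def\<close>)
qed

lemma triple_conseq:
  assumes "triple P T c A B" "\<And>s. A' s \<Longrightarrow> A s" "\<And>s. B s \<Longrightarrow> B' s" "T \<le> T'"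
  shows "triple P T' c A' B'"
  using assms unfolding triple_def by (meson order_trans)

lemma triple_lockstep:
  assumes "\<forall>I\<in>set c. \<not> is_jump I"
    and "\<And>s s'. A s \<Longrightarrow> mem s' = fst (lockstep P c (mem s, reg s)) \<Longrightarrow>
      (\<forall>i<P. reg s' i = snd (lockstep P c (mem s, reg s)) i) \<Longrightarrow> B s'"
  shows "triple P (length c) (\<lambda>_. c) A B"
  unfolding triple_def
proof (intro allI impI)
  fix q p s
  assume "placed q p c" "\<forall>i<P. pc s i = p" "A s"
  then show "\<exists>t\<le>length c. (\<forall>i<P. pc ((pram_step q P ^^ t) s) i = p + length c) \<and>
      B ((pram_step q P ^^ t) s)"
    using lockstep_run[of q p c P s "reg s"] assms by blast
qed

section \<open>Simulation of a program inside another one, with simultaneous exit\<close>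

section \<open>Barrier synchronisation\<close>

text \<open>Harmless where it is used, since register 0 holds 0 there.\<close>

abbreviation nop :: instr where "nop \<equiv> Const 0 0"

lemma concat_blocks_nth:
  assumes "\<forall>x\<in>set xs. length (f x) = d" "k < length xs" "j < d"
  shows "concat (map f xs) ! (d * k + j) = f (xs ! k) ! j"
  using assms
proof (induction xs arbitrary: k)
  case (Cons x xs)
  show ?case
  proof (cases k)
    case (Suc k')
    have "concat (map f (x # xs)) ! (d * k + j) = concat (map f xs) ! (d * k' + j)"
      using Cons.prems Suc by (simp add: nth_append algebra_simps)
    then show ?thesis using Cons Suc by simp
  qed (use Cons.prems in \<open>simp add: nth_append\<close>)
qed simp

lemma length_concat_blocks:
  "\<forall>x\<in>set xs. length (f x) = d \<Longrightarrow> length (concat (map f xs)) = d * length xs"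
  by (induction xs) auto

locale renaming =
  fixes \<rho> \<sigma> :: "nat \<Rightarrow> nat"
  assumes inj_\<rho>: "inj \<rho>" and \<rho>_gt: "\<And>r. 2 < \<rho> r"
    and inj_\<sigma>: "inj \<sigma>" and \<sigma>_pos: "\<And>b. 0 < \<sigma> b"
begin

text \<open>A jump becomes \<open>nop\<close> because control flow is handled by
  \<open>rename_jump\<close> in the last step of the round.\<close>

fun rename :: "instr \<Rightarrow> instr" where
  "rename (Const r c) = Const (\<rho> r) c"
| "rename (Pid r) = Pid (\<rho> r)"
| "rename (Add r s t) = Add (\<rho> r) (\<rho> s) (\<rho> t)"
| "rename (Sub r s t) = Sub (\<rho> r) (\<rho> s) (\<rho> t)"
| "rename (Load r b s) = Load (\<rho> r) (\<sigma> b) (\<rho> s)"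
| "rename (Store b s r) = Store (\<sigma> b) (\<rho> s) (\<rho> r)"
| "rename (Jz r l) = nop"

text \<open>Blocks have length five, so instruction \<open>l\<close> starts at offset
  \<open>5 * l\<close>; \<open>min l n\<close> sends every jump out of the program to the wait block
  behind the last instruction block.\<close>

fun rename_jump :: "nat \<Rightarrow> nat \<Rightarrow> instr \<Rightarrow> instr" where
  "rename_jump p n (Jz r l) = Jz (\<rho> r) (p + 5 * min l n)"
| "rename_jump p n _ = nop"

text \<open>
  Registers 0 and 1 hold the constants 0 and 1. Cell 0 of array 0 is a flag: in each round of five
  steps all processors clear it, the running ones then set it and execute one instruction, and the
  halted ones leave their loop as soon as they find it cleared.
\<close>

definition sync_block :: "nat \<Rightarrow> nat \<Rightarrow> instr \<Rightarrow> instr list" where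
  "sync_block p n I = [Store 0 0 0, Store 0 0 1, rename I, nop, rename_jump p n I]"

text \<open>\<open>Jz 2\<close> leaves the loop if the flag just read is cleared;
  \<open>Jz 0\<close> is an unconditional jump back, as register 0 holds 0.\<close>

definition wait_block :: "nat \<Rightarrow> nat \<Rightarrow> instr list" where
  "wait_block p n = [Store 0 0 0, nop, Load 2 0 0, Jz 2 (p + 5 * n + 5), Jz 0 (p + 5 * n)]"

definition sync :: "instr list \<Rightarrow> nat \<Rightarrow> instr list" where
  "sync prog p =
     concat (map (sync_block p (length prog)) prog) @ wait_block p (length prog)"

lemma length_sync_block [simp]: "length (sync_block p n I) = 5"
  by (simp add: sync_block_def)

lemma length_wait_block [simp]: "length (wait_block p n) = 5"
  by (simp add: wait_block_def)

lemma length_sync [simp]: "length (sync prog p) = 5 * length prog + 5"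
  by (simp add: sync_def length_concat_blocks[where d = 5])

lemma sync_nth:
  assumes "j < 5"
  shows "sync prog p ! (5 * min k (length prog) + j) =
    (if k < length prog then sync_block p (length prog) (prog ! k) ! j
     else wait_block p (length prog) ! j)"
proof (cases "k < length prog")
  case True
  have "5 * k + j < 5 * length prog" using True assms by simp
  then show ?thesis
    using True assms concat_blocks_nth[of prog "sync_block p (length prog)" 5 k j]
    by (simp add: sync_def nth_append length_concat_blocks[where d = 5])
next
  case False
  then show ?thesis
    by (simp add: sync_def nth_append length_concat_blocks[where d = 5])
qed

text \<open>\<open>a\<close> is the simulated state, \<open>s\<close> the simulating one, and
  \<open>u\<close> the state at entry, with which \<open>s\<close> still agrees outside the renamed
  registers and arrays. Register 2 and the flag cell are exempt, being used by the barrier. Program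
  counters are related separately, since they match only between rounds.\<close>

definition sim :: "nat \<Rightarrow> pram_state \<Rightarrow> pram_state \<Rightarrow> pram_state \<Rightarrow> bool" where
  "sim P u a s \<longleftrightarrow>
     (\<forall>i<P. reg s i 0 = 0 \<and> reg s i 1 = 1) \<and>
     (\<forall>i<P. \<forall>r. reg s i (\<rho> r) = reg a i r) \<and>
     (\<forall>i<P. \<forall>r. r \<notin> range \<rho> \<longrightarrow> r \<noteq> 2 \<longrightarrow> reg s i r = reg u i r) \<and>
     (\<forall>b. mem s (\<sigma> b) = mem a b) \<and>
     (\<forall>b. b \<notin> range \<sigma> \<longrightarrow> b \<noteq> 0 \<longrightarrow> mem s b = mem u b) \<and>
     (\<forall>c. c \<noteq> 0 \<longrightarrow> mem s 0 c = mem u 0 c)"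

lemma \<rho>_neq [simp]: "\<rho> r \<noteq> 0" "\<rho> r \<noteq> 1" "\<rho> r \<noteq> Suc 0" "\<rho> r \<noteq> 2"
    "0 \<noteq> \<rho> r" "1 \<noteq> \<rho> r" "Suc 0 \<noteq> \<rho> r" "2 \<noteq> \<rho> r"
  using \<rho>_gt[of r] by auto

lemma \<rho>_eq [simp]: "\<rho> r = \<rho> r' \<longleftrightarrow> r = r'"
  using inj_\<rho> by (auto dest: injD)

lemma \<sigma>_neq [simp]: "\<sigma> b \<noteq> 0" "0 \<noteq> \<sigma> b"
  using \<sigma>_pos[of b] by auto

lemma zero_notin_range_\<sigma>: "0 \<notin> range \<sigma>"
  by auto

lemma sim_frame:
  assumes "sim P u a s"
    and r: "\<forall>i<P. \<forall>r. r \<noteq> 2 \<longrightarrow> reg s' i r = reg s i r"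
    and m: "\<forall>b c. b \<noteq> 0 \<or> c \<noteq> 0 \<longrightarrow> mem s' b c = mem s b c"
  shows "sim P u a s'"
proof -
  have "mem s' b = mem s b" if "b \<noteq> 0" for b
    using m that by (intro ext) simp
  then show ?thesis using assms \<sigma>_pos unfolding sim_def by simp
qed

lemma write_req_rename:
  "\<forall>r. R' (\<rho> r) = R r \<Longrightarrow>
    write_req (rename I) R' = map_option (\<lambda>(b, a, v). (\<sigma> b, a, v)) (write_req I R)"
  by (cases I) auto

lemma next_reg_rename:
  assumes "\<forall>r. R' (\<rho> r) = R r" "\<forall>b. M' (\<sigma> b) = M b"
  shows "next_reg (rename I) i M' R' (\<rho> r) = next_reg I i M R r"
  using assms by (cases I) auto

text \<open>\<open>R' 0 = 0\<close> serves the jump case, where \<open>nop\<close> overwrites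
  register 0 with 0.\<close>

lemma next_reg_rename_other:
  assumes "R' 0 = 0" "r \<notin> range \<rho>"
  shows "next_reg (rename I) i M' R' r = R' r"
  using assms by (cases I) auto

text \<open>The third step of a round: running processors execute their renamed instruction while
  halted ones read the flag. As everyone acts in the same step, reads before writes and priorities
  carry over; a \<open>Load\<close> requests no write, just like a halted processor. The flag
  survives because \<sigma> avoids array 0.\<close>

lemma sim_instr:
  assumes sim: "sim P u a s"
    and J: "\<forall>i<P. pc s i < length q \<and> q ! pc s i =
      (if pc a i < length prog then rename (prog ! pc a i) else Load 2 0 0)"
  shows "sim P u (pram_step prog P a) (pram_step q P s)"
    and "mem (pram_step q P s) 0 = mem s 0"
proof -
  let ?I = "\<lambda>i. if pc a i < length prog then rename (prog ! pc a i) else Load 2 0 0"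
  let ?s = "pram_step q P s" and ?a = "pram_step prog P a"
  note st = pram_step_instrs[OF J]
  have "mem ?s = par_write P (\<lambda>i. write_req (?I i) (reg s i)) (mem s)" by (rule st(3))
  also have "\<dots> = par_write P
      (\<lambda>i. map_option (\<lambda>(b, a, v). (\<sigma> b, a, v)) (proc_write prog a i)) (mem s)"
  proof (rule par_write_cong)
    fix i assume "i < P"
    then have "\<forall>r. reg s i (\<rho> r) = reg a i r" using sim by (simp add: sim_def)
    from write_req_rename[OF this] show "write_req (?I i) (reg s i) =
        map_option (\<lambda>(b, a, v). (\<sigma> b, a, v)) (proc_write prog a i)"
      by (simp add: proc_write_def halted_def)
  qed
  finally have mem: "mem ?s = par_write P
      (\<lambda>i. map_option (\<lambda>(b, a, v). (\<sigma> b, a, v)) (proc_write prog a i)) (mem s)" .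
  have other: "mem ?s b = mem s b" if "b \<notin> range \<sigma>" for b
    unfolding mem by (rule par_write_rename_other[OF that])
  have ren: "mem ?s (\<sigma> b) = mem ?a b" for b
  proof -
    have "(\<lambda>b. mem s (\<sigma> b)) = mem a" using sim by (auto simp: sim_def)
    then show ?thesis unfolding mem mem_pram_step[of prog] par_write_rename[OF inj_\<sigma>] by simp
  qed
  have reg: "reg ?s i (\<rho> r) = reg ?a i r" if "i < P" for i r
  proof -
    have "\<forall>r. reg s i (\<rho> r) = reg a i r" "\<forall>b. mem s (\<sigma> b) = mem a b"
      using sim that by (simp_all add: sim_def)
    then show ?thesis unfolding st(2)[OF that]
      using that by (simp add: pram_step_def halted_def next_reg_rename)
  qed
  have reg_other: "reg ?s i r = reg s i r" if "i < P" "r \<notin> range \<rho>" "r \<noteq> 2" for i r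
  proof -
    have "reg s i 0 = 0" using sim that by (simp add: sim_def)
    then show ?thesis unfolding st(2)[OF that(1)]
      using that by (simp add: next_reg_rename_other)
  qed
  show "mem ?s 0 = mem s 0" by (rule other[OF zero_notin_range_\<sigma>])
  then show "sim P u ?a ?s"
    unfolding sim_def using other ren reg reg_other sim
    by (auto simp: sim_def image_iff)
qed

section \<open>Rounds of the simulation\<close>

context
  fixes P p :: nat and q prog :: "instr list"
  assumes P: "0 < P" and pl: "placed q p (sync prog p)"
begin

text \<open>Processors may be in different blocks \<open>k i\<close>, but they share the offset
  \<open>j\<close> within the block.\<close>

lemma sync_instrs:
  assumes "\<forall>i<P. pc s i = p + 5 * min (k i) (length prog) + j" "j < 5"
  shows "\<forall>i<P. pc s i < length q \<and> q ! pc s i =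
    (if k i < length prog then sync_block p (length prog) (prog ! k i) ! j
     else wait_block p (length prog) ! j)"
proof (intro allI impI)
  fix i assume "i < P"
  let ?k = "k i"
  have lt: "5 * min (k i) (length prog) + j < length (sync prog p)"
    using assms(2) by simp
  then have "q ! (p + (5 * min ?k (length prog) + j)) = sync prog p ! (5 * min ?k (length prog) + j)"
    using pl unfolding placed_def by blast
  moreover have "p + (5 * min ?k (length prog) + j) < length q"
    using pl lt unfolding placed_def by linarith
  ultimately show "pc s i < length q \<and> q ! pc s i =
    (if k i < length prog then sync_block p (length prog) (prog ! k i) ! j
     else wait_block p (length prog) ! j)"
    using assms \<open>i < P\<close> by (simp add: sync_nth add.assoc)
qed

text \<open>The steps common to an ordinary round and to the exit round: clear the flag, set it if
  someone is active, then execute or read.\<close>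

lemma sync_round_start:
  assumes sim: "sim P u a s" and pc: "\<forall>i<P. pc s i = p + 5 * min (pc a i) (length prog)"
  defines "s' \<equiv> (pram_step q P ^^ 3) s"
    and "flag \<equiv> if \<exists>i<P. pc a i < length prog then 1 else 0"
  shows "sim P u (pram_step prog P a) s'"
    and "\<forall>i<P. pc s' i = p + 5 * min (pc a i) (length prog) + 3"
    and "mem s' 0 0 = flag"
    and "\<forall>i<P. \<not> pc a i < length prog \<longrightarrow> reg s' i 2 = flag"
proof -
  let ?n = "length prog"
  define s1 where "s1 = pram_step q P s"
  define s2 where "s2 = pram_step q P s1"
  have s': "s' = pram_step q P s2"
    by (simp add: s'_def s1_def s2_def eval_nat_numeral)
  have reg01: "\<forall>i<P. reg s i 0 = 0 \<and> reg s i 1 = 1"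
    using sim by (simp add: sim_def)
  have I0: "\<forall>i<P. pc s i < length q \<and> q ! pc s i = Store 0 0 0"
    using sync_instrs[of s "pc a" 0] pc by (simp add: sync_block_def wait_block_def)
  note st0 = pram_step_instrs[OF I0, folded s1_def]
  have pc1: "\<forall>i<P. pc s1 i = p + 5 * min (pc a i) ?n + 1"
    using st0(1) pc by simp
  have reg1: "\<forall>i<P. reg s1 i = reg s i" using st0(2) by simp
  have "mem s1 = par_write P (\<lambda>i. write_req (Store 0 0 0) (reg s i)) (mem s)" by (rule st0(3))
  also have "\<dots> = par_write P (\<lambda>i. Some (0, 0, 0)) (mem s)"
    by (rule par_write_cong) (use reg01 in simp)
  finally have mem1: "mem s1 = (mem s)(0 := (mem s 0)(0 := 0))"
    using P par_write_same[of P "\<lambda>i. Some (0, 0, 0)" 0 0 0 "mem s"] by auto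
  have I1: "\<forall>i<P. pc s1 i < length q \<and> q ! pc s1 i =
      (if pc a i < ?n then Store 0 0 1 else nop)"
    using sync_instrs[OF pc1] by (simp add: sync_block_def wait_block_def)
  note st1 = pram_step_instrs[OF I1, folded s2_def]
  have pc2: "\<forall>i<P. pc s2 i = p + 5 * min (pc a i) ?n + 2"
    using st1(1) pc1 by simp
  have reg2: "\<forall>i<P. reg s2 i = reg s i"
    using st1(2) reg1 reg01 by (simp add: fun_upd_idem)
  let ?w = "\<lambda>i. if pc a i < ?n then Some (0, 0, 1) else (None :: (nat \<times> nat \<times> nat) option)"
  have "mem s2 = par_write P (\<lambda>i. write_req (if pc a i < ?n then Store 0 0 1 else nop) (reg s1 i)) (mem s1)"
    by (rule st1(3))
  also have "\<dots> = par_write P ?w (mem s1)"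
    by (rule par_write_cong) (use reg01 reg1 in simp)
  also have "\<dots> = (if \<exists>i<P. ?w i \<noteq> None then (mem s1)(0 := (mem s1 0)(0 := 1)) else mem s1)"
    by (rule par_write_same) simp
  also have "(\<exists>i<P. ?w i \<noteq> None) \<longleftrightarrow> (\<exists>i<P. pc a i < ?n)" by auto
  finally have mem2: "mem s2 = (mem s)(0 := (mem s 0)(0 := flag))"
    by (cases "\<exists>i<P. pc a i < ?n") (auto simp: mem1 flag_def fun_eq_iff)
  have sim2: "sim P u a s2"
    using sim by (rule sim_frame) (simp_all add: reg2 mem2)
  have I2: "\<forall>i<P. pc s2 i < length q \<and> q ! pc s2 i =
      (if pc a i < ?n then rename (prog ! pc a i) else Load 2 0 0)"
    using sync_instrs[OF pc2] by (simp add: sync_block_def wait_block_def)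
  note st2 = pram_step_instrs[OF I2, folded s']
  show "sim P u (pram_step prog P a) s'"
    unfolding s' by (rule sim_instr(1)[OF sim2 I2])
  show "mem s' 0 0 = flag"
    unfolding s' sim_instr(2)[OF sim2 I2] by (simp add: mem2)
  have "\<not> is_jump (rename I)" for I by (cases I) auto
  then show "\<forall>i<P. pc s' i = p + 5 * min (pc a i) ?n + 3"
    using st2(1) pc2 by (simp add: next_pc_not_jump)
  show "\<forall>i<P. \<not> pc a i < ?n \<longrightarrow> reg s' i 2 = flag"
    using st2(2) reg2 reg01 by (simp add: mem2)
qed

text \<open>An active processor has set the flag, so the waiting ones jump back to the start of
  their block while the others perform their jumps, and all begin the next round together.\<close>

lemma sync_round:
  assumes sim: "sim P u a s" and pc: "\<forall>i<P. pc s i = p + 5 * min (pc a i) (length prog)"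
    and act: "\<exists>i<P. pc a i < length prog"
  shows "sim P u (pram_step prog P a) ((pram_step q P ^^ 5) s) \<and>
    (\<forall>i<P. pc ((pram_step q P ^^ 5) s) i = p + 5 * min (pc (pram_step prog P a) i) (length prog))"
proof -
  let ?n = "length prog" and ?a = "pram_step prog P a"
  define s3 where "s3 = (pram_step q P ^^ 3) s"
  define s4 where "s4 = pram_step q P s3"
  define s5 where "s5 = pram_step q P s4"
  have s5: "(pram_step q P ^^ 5) s = s5"
    by (simp add: s3_def s4_def s5_def eval_nat_numeral)
  note start = sync_round_start[OF sim pc, folded s3_def]
  have reg0: "\<forall>i<P. reg s3 i 0 = 0" using start(1) by (simp add: sim_def)
  have I3: "\<forall>i<P. pc s3 i < length q \<and> q ! pc s3 i =
      (if pc a i < ?n then nop else Jz 2 (p + 5 * ?n + 5))"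
    using sync_instrs[OF start(2)] by (simp add: sync_block_def wait_block_def)
  note st3 = pram_step_instrs[OF I3, folded s4_def]
  have pc4: "\<forall>i<P. pc s4 i = p + 5 * min (pc a i) ?n + 4"
    using st3(1) start(2,4) act by simp
  have reg4: "\<forall>i<P. reg s4 i = reg s3 i"
    using st3(2) reg0 by (simp add: fun_upd_idem)
  have "mem s4 = par_write P (\<lambda>i. write_req (if pc a i < ?n then nop else Jz 2 (p + 5 * ?n + 5)) (reg s3 i)) (mem s3)"
    by (rule st3(3))
  also have "\<dots> = par_write P (\<lambda>i. None) (mem s3)"
    by (rule par_write_cong) simp
  finally have mem4: "mem s4 = mem s3" by simp
  have I4: "\<forall>i<P. pc s4 i < length q \<and> q ! pc s4 i =
      (if pc a i < ?n then rename_jump p ?n (prog ! pc a i) else Jz 0 (p + 5 * ?n))"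
    using sync_instrs[OF pc4] by (simp add: sync_block_def wait_block_def)
  note st4 = pram_step_instrs[OF I4, folded s5_def]
  have reg5: "\<forall>i<P. reg s5 i = reg s3 i"
  proof (intro allI impI)
    fix i assume i: "i < P"
    have "next_reg (rename_jump p ?n I) i M R = R" if "R 0 = 0" for I M R
      using that by (cases I) (simp_all add: fun_upd_idem)
    then show "reg s5 i = reg s3 i"
      using st4(2)[OF i] i reg4 reg0 by simp
  qed
  have "mem s5 = par_write P (\<lambda>i. write_req (if pc a i < ?n
      then rename_jump p ?n (prog ! pc a i) else Jz 0 (p + 5 * ?n)) (reg s4 i)) (mem s4)"
    by (rule st4(3))
  also have "\<dots> = par_write P (\<lambda>i. None) (mem s4)"
  proof (rule par_write_cong)
    have "write_req (rename_jump p ?n I) R = None" for I R by (cases I) simp_all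
    then show "write_req (if pc a i < ?n
      then rename_jump p ?n (prog ! pc a i) else Jz 0 (p + 5 * ?n)) (reg s4 i) = None" for i
      by simp
  qed
  finally have mem5: "mem s5 = mem s3" by (simp add: mem4)
  have "sim P u ?a s5"
    using start(1) by (rule sim_frame) (simp_all add: reg5 mem5)
  moreover have "pc s5 i = p + 5 * min (pc ?a i) ?n" if i: "i < P" for i
  proof (cases "pc a i < ?n")
    case False
    then have "pc ?a i = pc a i" by (simp add: pram_step_def halted_def)
    then show ?thesis using False st4(1)[OF i] i reg4 reg0 by simp
  next
    case True
    have "next_pc (rename_jump p ?n I) (reg s4 i) (pc s4 i) =
        p + 5 * min (next_pc I (reg a i) (pc a i)) ?n" if I: "I = prog ! pc a i" for I
    proof (cases "is_jump I")
      case True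
      then obtain r l where I': "I = Jz r l" by (cases I) auto
      \<comment> \<open>The test comes at the end of the round, when the registers already are those
        of \<open>?a\<close>; a jump leaves registers alone, so it sees the right value.\<close>
      then have "reg ?a i r = reg a i r"
        using I i by (simp add: pram_step_def)
      moreover have "reg s3 i (\<rho> r) = reg ?a i r" using start(1) i by (simp add: sim_def)
      ultimately show ?thesis
        using I' reg4 i pc4 \<open>pc a i < ?n\<close> by simp
    next
      case False
      then have "\<not> is_jump (rename_jump p ?n I)" by (cases I) auto
      then show ?thesis using False pc4 i \<open>pc a i < ?n\<close> by (simp add: next_pc_not_jump)
    qed
    then show ?thesis
      using True st4(1)[OF i] i by (simp add: pram_step_def halted_def)
  qed
  ultimately show ?thesis unfolding s5 by blast
qed

text \<open>Nobody sets the flag, so everyone takes the exit jump in the fourth step of the same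
  round; a step of \<open>prog\<close> no longer changes \<open>a\<close>.\<close>

lemma sync_exit:
  assumes sim: "sim P u a s" and pc: "\<forall>i<P. pc s i = p + 5 * min (pc a i) (length prog)"
    and halted: "\<forall>i<P. halted prog a i"
  shows "sim P u a ((pram_step q P ^^ 4) s) \<and> mem ((pram_step q P ^^ 4) s) 0 0 = 0 \<and>
    (\<forall>i<P. pc ((pram_step q P ^^ 4) s) i = p + 5 * length prog + 5)"
proof -
  let ?n = "length prog"
  define s3 where "s3 = (pram_step q P ^^ 3) s"
  define s4 where "s4 = pram_step q P s3"
  have s4: "(pram_step q P ^^ 4) s = s4"
    by (simp add: s3_def s4_def eval_nat_numeral)
  have inactive: "\<not> pc a i < ?n" if "i < P" for i
    using halted that by (simp add: halted_def not_less)
  then have none: "\<not> (\<exists>i<P. pc a i < ?n)" by blast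
  note start = sync_round_start[OF sim pc, folded s3_def, unfolded pram_step_halted[OF halted]]
  have I3: "\<forall>i<P. pc s3 i < length q \<and> q ! pc s3 i = Jz 2 (p + 5 * ?n + 5)"
    using sync_instrs[OF start(2)] inactive by (simp add: wait_block_def)
  note st3 = pram_step_instrs[OF I3, folded s4_def]
  have "mem s4 = mem s3" using st3(3) by simp
  moreover have "\<forall>i<P. reg s4 i = reg s3 i" using st3(2) by simp
  moreover have "\<forall>i<P. pc s4 i = p + 5 * ?n + 5"
    using st3(1) start(2,4) inactive none by simp
  moreover have "mem s3 0 0 = 0" using start(3) none by simp
  moreover have "sim P u a s4"
    using start(1) by (rule sim_frame) (use calculation in simp_all)
  ultimately show ?thesis unfolding s4 by simp
qed

text \<open>Five steps per simulated step and four for the exit. If all processors halt before time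
  \<open>t\<close>, the loop ends early, hence only an upper bound on \<open>T\<close>.\<close>

lemma sync_run:
  assumes "sim P u a s" "\<forall>i<P. pc s i = p + 5 * min (pc a i) (length prog)"
    and "\<forall>i<P. halted prog ((pram_step prog P ^^ t) a) i"
  shows "\<exists>T\<le>5 * t + 4. (\<forall>i<P. pc ((pram_step q P ^^ T) s) i = p + (5 * length prog + 5)) \<and>
    sim P u ((pram_step prog P ^^ t) a) ((pram_step q P ^^ T) s) \<and>
    mem ((pram_step q P ^^ T) s) 0 0 = 0"
  using assms
proof (induction t arbitrary: a s)
  case 0
  then have "sim P u a ((pram_step q P ^^ 4) s) \<and> mem ((pram_step q P ^^ 4) s) 0 0 = 0 \<and>
    (\<forall>i<P. pc ((pram_step q P ^^ 4) s) i = p + 5 * length prog + 5)"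
    by (intro sync_exit) simp_all
  then show ?case by (intro exI[of _ 4]) (simp add: add.assoc)
next
  case (Suc t)
  show ?case
  proof (cases "\<exists>i<P. pc a i < length prog")
    case True
    let ?s = "(pram_step q P ^^ 5) s" and ?a = "pram_step prog P a"
    have "sim P u ?a ?s \<and> (\<forall>i<P. pc ?s i = p + 5 * min (pc ?a i) (length prog))"
      by (rule sync_round[OF Suc.prems(1,2) True])
    moreover have eq: "(pram_step prog P ^^ Suc t) a = (pram_step prog P ^^ t) ?a"
      by (simp add: funpow_swap1)
    ultimately obtain T where T: "T \<le> 5 * t + 4"
      "\<forall>i<P. pc ((pram_step q P ^^ T) ?s) i = p + (5 * length prog + 5)"
      "sim P u ((pram_step prog P ^^ t) ?a) ((pram_step q P ^^ T) ?s)"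
      "mem ((pram_step q P ^^ T) ?s) 0 0 = 0"
      using Suc.IH[of ?a ?s] Suc.prems(3) by auto
    have "(pram_step q P ^^ (T + 5)) s = (pram_step q P ^^ T) ?s"
      by (simp add: funpow_add)
    then show ?thesis using T(2-4) unfolding eq
      by (intro exI[of _ "T + 5"]) (use T(1) in simp)
  next
    case False
    then have h: "\<forall>i<P. halted prog a i" by (auto simp: halted_def)
    have "sim P u a ((pram_step q P ^^ 4) s) \<and> mem ((pram_step q P ^^ 4) s) 0 0 = 0 \<and>
      (\<forall>i<P. pc ((pram_step q P ^^ 4) s) i = p + 5 * length prog + 5)"
      by (rule sync_exit[OF Suc.prems(1,2) h])
    then show ?thesis unfolding pram_steps_halted[OF h]
      by (intro exI[of _ 4]) (simp add: add.assoc)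
  qed
qed

end

lemma sync_triple:
  assumes "0 < P" "\<forall>i<P. pc a i = 0" "\<forall>i<P. halted prog ((pram_step prog P ^^ t) a) i"
  shows "triple P (5 * t + 4) (sync prog) (\<lambda>s. sim P u a s)
    (\<lambda>s. sim P u ((pram_step prog P ^^ t) a) s \<and> mem s 0 0 = 0)"
  unfolding triple_def
proof (intro allI impI)
  fix q p s
  assume "placed q p (sync prog p)" "\<forall>i<P. pc s i = p" "sim P u a s"
  then show "\<exists>T\<le>5 * t + 4. (\<forall>i<P. pc ((pram_step q P ^^ T) s) i = p + length (sync prog p)) \<and>
      sim P u ((pram_step prog P ^^ t) a) ((pram_step q P ^^ T) s) \<and>
      mem ((pram_step q P ^^ T) s) 0 0 = 0"
    using sync_run[of P q p prog u a s t] assms by simp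
qed

end

section \<open>Calls in disjoint frames of registers and arrays\<close>

section \<open>Subroutine calls\<close>

text \<open>Fixes the state at entry, which the relation \<open>sim\<close> needs as its reference
  \<open>u\<close>.\<close>

lemma triple_state:
  assumes "\<And>u. A u \<Longrightarrow> triple P T c (\<lambda>s. s = u) B"
  shows "triple P T c A B"
  using assms unfolding triple_def by blast

text \<open>Pairing gives every call \<open>j\<close> its own infinite set of registers above the
  five reserved ones. Each frame serves one call only, so it is still zero when a program starts in
  it.\<close>

definition frame_reg :: "nat \<Rightarrow> nat \<Rightarrow> nat" where
  "frame_reg j r = 5 + prod_encode (j, r)"

text \<open>Array 0 and the input arrays 1 to \<open>m\<close> stay outside all frames.\<close>

definition frame_arr :: "nat \<Rightarrow> nat \<Rightarrow> nat \<Rightarrow> nat" where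
  "frame_arr m j b = Suc m + prod_encode (j, b)"

lemma frame_reg_eq [simp]: "frame_reg j r = frame_reg j' r' \<longleftrightarrow> j = j' \<and> r = r'"
  by (simp add: frame_reg_def)

lemma frame_arr_eq [simp]: "frame_arr m j b = frame_arr m j' b' \<longleftrightarrow> j = j' \<and> b = b'"
  by (simp add: frame_arr_def)

lemma frame_reg_gt: "r < 5 \<Longrightarrow> r \<noteq> frame_reg j r'"
  by (simp add: frame_reg_def)

lemma frame_arr_gt: "b \<le> m \<Longrightarrow> b \<noteq> frame_arr m j b'"
  by (simp add: frame_arr_def)

lemma frame_arr_pos [simp]: "frame_arr m j b \<noteq> 0" "0 \<noteq> frame_arr m j b"
  by (simp_all add: frame_arr_def)

interpretation frame: renaming "frame_reg j" "frame_arr m j" for j m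
  by unfold_locales (auto simp: inj_def frame_reg_def frame_arr_def)

text \<open>
  Register 3 holds the processor index and register 4 is scratch space; frames from \<open>j\<close> on are
  unused, and \<open>A\<close> lists arrays together with the words that they store.
\<close>

definition ready :: "nat \<Rightarrow> nat \<Rightarrow> nat \<Rightarrow> (nat \<times> 'a::finite list) set \<Rightarrow> pram_state \<Rightarrow> bool" where
  "ready P m j A s \<longleftrightarrow>
     (\<forall>i<P. reg s i 0 = 0 \<and> reg s i 1 = 1 \<and> reg s i 3 = i) \<and>
     (\<forall>i<P. \<forall>j'\<ge>j. \<forall>r. reg s i (frame_reg j' r) = 0) \<and>
     (\<forall>j'\<ge>j. \<forall>b. mem s (frame_arr m j' b) = (\<lambda>_. 0)) \<and> mem s 0 = (\<lambda>_. 0) \<and>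
     (\<forall>b w. (b, w) \<in> A \<longrightarrow> mem s b = word_cells w)"

text \<open>Protects the words listed in \<open>A\<close> from later calls and from the flag;
  results kept in frames below \<open>j\<close> are allowed.\<close>

definition avoids_frames :: "nat \<Rightarrow> nat \<Rightarrow> (nat \<times> 'b) set \<Rightarrow> bool" where
  "avoids_frames m j A \<longleftrightarrow>
     (\<forall>b w. (b, w) \<in> A \<longrightarrow> b \<noteq> 0 \<and> (\<forall>j'\<ge>j. \<forall>b'. b \<noteq> frame_arr m j' b'))"

lemma avoids_framesD:
  assumes "avoids_frames m j A" "(b, w) \<in> A"
  shows "b \<noteq> 0" "j \<le> j' \<Longrightarrow> b \<noteq> frame_arr m j' b'"
  using assms by (auto simp: avoids_frames_def)

text \<open>The stage between \<open>ready\<close> and the start of the subprogram: frame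
  \<open>j\<close> looks like the initial state of a machine with input \<open>ws\<close>.\<close>

definition loaded ::
  "nat \<Rightarrow> nat \<Rightarrow> nat \<Rightarrow> (nat \<times> 'a::finite list) set \<Rightarrow> 'a list list \<Rightarrow> pram_state \<Rightarrow> bool" where
  "loaded P m j A ws s \<longleftrightarrow>
     (\<forall>i<P. reg s i 0 = 0 \<and> reg s i 1 = 1 \<and> reg s i 3 = i) \<and>
     (\<forall>i<P. \<forall>j'\<ge>j. \<forall>r. reg s i (frame_reg j' r) = 0) \<and>
     (\<forall>j'>j. \<forall>b. mem s (frame_arr m j' b) = (\<lambda>_. 0)) \<and> mem s 0 = (\<lambda>_. 0) \<and>
     (\<forall>b w. (b, w) \<in> A \<longrightarrow> mem s b = word_cells w) \<and>
     (\<forall>b. mem s (frame_arr m j b) = mem (init_state ws) b)"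

lemma mem_init_state_Nil: "mem (init_state []) = (\<lambda>_ _. 0)"
  by (intro ext) (simp add: init_state_def)

lemma ready_loaded: "ready P m j A s \<Longrightarrow> loaded P m j A [] s"
  by (simp add: ready_def loaded_def mem_init_state_Nil)

lemma mem_init_state_take:
  "k < length ws \<Longrightarrow> mem (init_state (take (Suc k) ws)) =
    (mem (init_state (take k ws)))(Suc k := word_cells (ws ! k))"
  by (intro ext) (auto simp: init_state_def)

lemma word_cells_ge: "length w \<le> a \<Longrightarrow> word_cells w a = 0"
  by (simp add: word_cells_def)

section \<open>Copying words between arrays\<close>

definition copy_array :: "nat \<Rightarrow> nat \<Rightarrow> instr list" where
  "copy_array b b' = [Load 4 b 3, Store b' 3 4]"

lemma length_copy_array [simp]: "length (copy_array b b') = 2"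
  by (simp add: copy_array_def)

lemma lockstep_copy_array:
  assumes "\<forall>i<P. R i 3 = i"
  shows "fst (lockstep P (copy_array b b') (M, R)) =
      M(b' := (\<lambda>a. if a < P then M b a else M b' a))"
    and "i < P \<Longrightarrow> snd (lockstep P (copy_array b b') (M, R)) i = (R i)(4 := M b i)"
proof -
  have "par_write P (\<lambda>i. Some (b', R i 3, M b (R i 3))) M =
      par_write P (\<lambda>i. Some (b', i, M b i)) M"
    by (rule par_write_cong) (use assms in simp)
  then show "fst (lockstep P (copy_array b b') (M, R)) =
      M(b' := (\<lambda>a. if a < P then M b a else M b' a))"
    by (simp add: copy_array_def par_write_index)
  show "i < P \<Longrightarrow> snd (lockstep P (copy_array b b') (M, R)) i = (R i)(4 := M b i)"
    using assms by (simp add: copy_array_def)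
qed

text \<open>Only cells below \<open>P\<close> are copied; behind the word both arrays are zero
  anyway.\<close>

lemma copy_word:
  assumes "M b = word_cells w" "M b' = (\<lambda>_. 0)" "length w \<le> P"
  shows "(\<lambda>a. if a < P then M b a else M b' a) = word_cells w"
  using assms by (auto simp: word_cells_ge)

lemma load_triple:
  assumes "k < length ws" "(src, ws ! k) \<in> A" "length (ws ! k) \<le> P" "avoids_frames m j A"
  shows "triple P 2 (\<lambda>_. copy_array src (frame_arr m j (Suc k)))
    (loaded P m j A (take k ws)) (loaded P m j A (take (Suc k) ws))"
proof -
  let ?c = "copy_array src (frame_arr m j (Suc k))"
  have "triple P (length ?c) (\<lambda>_. ?c)
    (loaded P m j A (take k ws)) (loaded P m j A (take (Suc k) ws))"
  proof (rule triple_lockstep)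
    show "\<forall>I\<in>set ?c. \<not> is_jump I" by (simp add: copy_array_def)
  next
    fix s s' :: pram_state
    assume s: "loaded P m j A (take k ws) s"
      and mem: "mem s' = fst (lockstep P ?c (mem s, reg s))"
      and reg: "\<forall>i<P. reg s' i = snd (lockstep P ?c (mem s, reg s)) i"
    have pid: "\<forall>i<P. reg s i 3 = i" using s by (simp add: loaded_def)
    have src: "mem s src = word_cells (ws ! k)" using s assms(2) by (simp add: loaded_def)
    have dst: "mem s (frame_arr m j (Suc k)) = (\<lambda>_. 0)"
      using s by (auto simp: loaded_def init_state_def)
    have mem': "mem s' = (mem s)(frame_arr m j (Suc k) := word_cells (ws ! k))"
      unfolding mem lockstep_copy_array(1)[of P "reg s", OF pid] copy_word[of "mem s", OF src dst assms(3)] ..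
    have reg': "\<forall>i<P. \<forall>r. r \<noteq> 4 \<longrightarrow> reg s' i r = reg s i r"
      using reg lockstep_copy_array(2)[of P "reg s", OF pid] by simp
    have ne: "frame_reg j' r \<noteq> 4" for j' r using frame_reg_gt[of 4 j' r] by simp
    have "mem s' b = word_cells w" if "(b, w) \<in> A" for b w
      using s that avoids_framesD(2)[OF assms(4) that, of j] by (simp add: mem' loaded_def)
    then show "loaded P m j A (take (Suc k) ws) s'"
      using s unfolding loaded_def mem_init_state_take[OF assms(1)]
      by (simp add: mem' reg' ne)
  qed
  then show ?thesis by simp
qed

fun load_code :: "nat \<Rightarrow> nat \<Rightarrow> nat \<Rightarrow> nat list \<Rightarrow> instr list" where
  "load_code m j k [] = []"
| "load_code m j k (b # bs) = copy_array b (frame_arr m j (Suc k)) @ load_code m j (Suc k) bs"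

lemma load_code_triple:
  assumes "k + length bs = length ws" "\<forall>l<length bs. (bs ! l, ws ! (k + l)) \<in> A"
    and "\<forall>w\<in>set ws. length w \<le> P" "avoids_frames m j A"
  shows "triple P (2 * length bs) (\<lambda>_. load_code m j k bs)
    (loaded P m j A (take k ws)) (loaded P m j A ws)"
  using assms(1,2)
proof (induction bs arbitrary: k)
  case Nil
  then show ?case by (auto simp: triple_def)
next
  case (Cons b bs)
  have k: "k < length ws" "(b, ws ! k) \<in> A" using Cons.prems by auto
  have "\<forall>l<length bs. (bs ! l, ws ! (Suc k + l)) \<in> A"
    using Cons.prems(2) by (metis Suc_less_eq add_Suc_shift length_Cons nth_Cons_Suc)
  then have "triple P (2 * length bs) (\<lambda>_. load_code m j (Suc k) bs)
    (loaded P m j A (take (Suc k) ws)) (loaded P m j A ws)"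
    using Cons.IH[of "Suc k"] Cons.prems(1) by simp
  from triple_seq[OF load_triple[OF k _ assms(4)] this] show ?case
    using assms(3) k by (simp add: seq_def[abs_def])
qed

definition call :: "nat \<Rightarrow> nat \<Rightarrow> nat list \<Rightarrow> instr list \<Rightarrow> nat \<Rightarrow> instr list" where
  "call m j bs prog = seq (\<lambda>_. load_code m j 0 bs) (frame.sync j m prog)"

text \<open>The result appears in \<open>frame_arr m j 0\<close>, the renamed output array.
  Everything outside frame \<open>j\<close> is as at entry by \<open>sim\<close>, which preserves
  \<open>A\<close> and the later frames.\<close>

lemma call_triple:
  assumes P: "0 < P" and out: "pram_outputs_in prog P ws t w"
    and bs: "length bs = length ws" "\<forall>l<length ws. (bs ! l, ws ! l) \<in> A"
    and len: "\<forall>w\<in>set ws. length w \<le> P" and av: "avoids_frames m j A"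
  shows "triple P (2 * length bs + (5 * t + 4)) (call m j bs prog)
    (ready P m j A) (ready P m (Suc j) (insert (frame_arr m j 0, w) A))"
  unfolding call_def
proof (rule triple_seq)
  have "triple P (2 * length bs) (\<lambda>_. load_code m j 0 bs)
      (loaded P m j A (take 0 ws)) (loaded P m j A ws)"
    using bs len av by (intro load_code_triple) auto
  then show "triple P (2 * length bs) (\<lambda>_. load_code m j 0 bs) (ready P m j A) (loaded P m j A ws)"
    by (rule triple_conseq) (simp_all add: ready_loaded)
next
  let ?f = "(pram_step prog P ^^ t) (init_state ws)"
  have halted: "\<forall>i<P. halted prog ?f i" and w: "mem ?f 0 = word_cells w"
    using out by (auto simp: pram_outputs_in_def Let_def)
  show "triple P (5 * t + 4) (frame.sync j m prog) (loaded P m j A ws)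
     (ready P m (Suc j) (insert (frame_arr m j 0, w) A))"
  proof (rule triple_state)
    fix u assume u: "loaded P m j A ws u"
    have sim: "frame.sim j m P u (init_state ws) u"
      using u by (simp add: frame.sim_def loaded_def init_state_def)
    have "triple P (5 * t + 4) (frame.sync j m prog) (frame.sim j m P u (init_state ws))
      (\<lambda>s. frame.sim j m P u ?f s \<and> mem s 0 0 = 0)"
      by (rule frame.sync_triple[OF P _ halted]) (simp add: init_state_def)
    then show "triple P (5 * t + 4) (frame.sync j m prog) (\<lambda>s. s = u)
      (ready P m (Suc j) (insert (frame_arr m j 0, w) A))"
    proof (rule triple_conseq)
      fix s assume s: "frame.sim j m P u ?f s \<and> mem s 0 0 = 0"
      have reg: "reg s i r = reg u i r" if "i < P" "r \<notin> range (frame_reg j)" "r \<noteq> 2" for i r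
        using s that by (simp add: frame.sim_def)
      have arr: "mem s b = mem u b" if "b \<notin> range (frame_arr m j)" "b \<noteq> 0" for b
        using s that by (simp add: frame.sim_def)
      \<comment> \<open>\<open>sim\<close> speaks of all cells of array 0 except the flag, which the
        exit leaves cleared.\<close>
      have "mem s 0 c = 0" for c
        using s u by (cases "c = 0") (simp_all add: frame.sim_def loaded_def)
      then have "mem s 0 = (\<lambda>_. 0)" by (intro ext)
      moreover have "reg s i 0 = 0 \<and> reg s i 1 = 1 \<and> reg s i 3 = i" if "i < P" for i
      proof -
        have "3 \<notin> range (frame_reg j)" by (auto simp: frame_reg_def)
        then show ?thesis using s u reg[of i 3] that by (simp add: frame.sim_def loaded_def)
      qed
      moreover have "reg s i (frame_reg j' r) = 0" if "i < P" "Suc j \<le> j'" for i j' r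
      proof -
        have "frame_reg j' r \<notin> range (frame_reg j)" "frame_reg j' r \<noteq> 2"
          using that frame_reg_gt[of 2 j' r] by auto
        then show ?thesis using reg[of i "frame_reg j' r"] u that by (simp add: loaded_def)
      qed
      moreover have "mem s (frame_arr m j' b) = (\<lambda>_. 0)" if "Suc j \<le> j'" for j' b
      proof -
        have "frame_arr m j' b \<notin> range (frame_arr m j)" using that by auto
        then show ?thesis using arr[of "frame_arr m j' b"] u that by (simp add: loaded_def)
      qed
      moreover have "mem s b = word_cells v" if "(b, v) \<in> A" for b v
      proof -
        have "b \<notin> range (frame_arr m j)" "b \<noteq> 0"
          using avoids_framesD[OF av that] by auto
        then show ?thesis using arr[of b] u that by (simp add: loaded_def)
      qed
      moreover have "mem s (frame_arr m j 0) = word_cells w"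
        using s w by (simp add: frame.sim_def)
      ultimately show "ready P m (Suc j) (insert (frame_arr m j 0, w) A) s"
        unfolding ready_def by auto
    qed (use sim in simp_all)
  qed
qed

fun calls :: "nat \<Rightarrow> nat \<Rightarrow> nat list \<Rightarrow> instr list list \<Rightarrow> nat \<Rightarrow> instr list" where
  "calls m j bs [] = (\<lambda>_. [])"
| "calls m j bs (prog # progs) = seq (call m j bs prog) (calls m (Suc j) bs progs)"

definition results :: "nat \<Rightarrow> nat \<Rightarrow> 'b list \<Rightarrow> (nat \<times> 'b) set" where
  "results m j outs = set (zip (map (\<lambda>k. frame_arr m k 0) [j..<j + length outs]) outs)"

lemma results_Cons:
  "results m j (w # outs) = insert (frame_arr m j 0, w) (results m (Suc j) outs)"
  by (simp add: results_def upt_conv_Cons del: upt_Suc)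

lemma avoids_frames_insert:
  "avoids_frames m j A \<Longrightarrow> avoids_frames m (Suc j) (insert (frame_arr m j 0, w) A)"
  unfolding avoids_frames_def by (metis Suc_leD Suc_n_not_le_n frame_arr_eq frame_arr_pos(1) insertE prod.inject)

lemma calls_triple:
  assumes P: "0 < P"
    and outs: "list_all2 (\<lambda>prog w. \<exists>t\<le>T. pram_outputs_in prog P ws t w) progs outs"
    and bs: "length bs = length ws" "\<forall>l<length ws. (bs ! l, ws ! l) \<in> A"
    and len: "\<forall>w\<in>set ws. length w \<le> P" and av: "avoids_frames m j A"
  shows "triple P (length progs * (2 * length bs + (5 * T + 4))) (calls m j bs progs)
    (ready P m j A) (ready P m (j + length progs) (A \<union> results m j outs))"
  using outs bs av
proof (induction progs outs arbitrary: j A rule: list_all2_induct)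
  case Nil
  then show ?case by (auto simp: triple_def results_def)
next
  case (Cons prog progs w outs)
  let ?A = "insert (frame_arr m j 0, w) A"
  obtain t where t: "t \<le> T" "pram_outputs_in prog P ws t w" using Cons by blast
  have "triple P (2 * length bs + (5 * t + 4)) (call m j bs prog)
    (ready P m j A) (ready P m (Suc j) ?A)"
    by (rule call_triple[OF P t(2) Cons.prems(1,2) len Cons.prems(3)])
  moreover have "triple P (length progs * (2 * length bs + (5 * T + 4)))
     (calls m (Suc j) bs progs) (ready P m (Suc j) ?A)
     (ready P m (Suc j + length progs) (?A \<union> results m (Suc j) outs))"
    using Cons.prems by (intro Cons.IH avoids_frames_insert) auto
  ultimately have "triple P (2 * length bs + (5 * t + 4) + length progs * (2 * length bs + (5 * T + 4)))
     (calls m j bs (prog # progs)) (ready P m j A)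
     (ready P m (Suc j + length progs) (?A \<union> results m (Suc j) outs))"
    unfolding calls.simps by (rule triple_seq)
  then show ?case
    by (rule triple_conseq) (use t in \<open>simp_all add: results_Cons\<close>)
qed

lemma avoids_frames_results:
  assumes "avoids_frames m j A"
  shows "avoids_frames m (j + length outs) (A \<union> results m j outs)"
  using assms
proof (induction outs arbitrary: j A)
  case (Cons w outs)
  from Cons.IH[OF avoids_frames_insert[OF Cons.prems]] show ?case
    by (simp add: results_Cons)
qed (simp add: results_def)

text \<open>Frames 0 to \<open>l - 1\<close> belong to the inner programs and frame \<open>l\<close>
  to the outer one, whose result is finally moved to the true output array. Register 0 is zero from
  the start and needs no setup.\<close>

definition compose_prog :: "nat \<Rightarrow> instr list list \<Rightarrow> instr list \<Rightarrow> instr list" where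
  "compose_prog m progs prog = (let l = length progs in
     seq (\<lambda>_. [Const 1 1, Pid 3])
       (seq (calls m 0 [1..<Suc m] progs)
         (seq (call m l (map (\<lambda>k. frame_arr m k 0) [0..<l]) prog)
           (\<lambda>_. copy_array (frame_arr m l 0) 0))) 0)"

text \<open>The length assumptions provide one processor per symbol for every word that has to be
  copied.\<close>

lemma compose_prog_outputs:
  fixes ws :: "'a::finite list list"
  assumes P: "0 < P"
    and outs: "list_all2 (\<lambda>prog w. \<exists>t\<le>T. pram_outputs_in prog P ws t w) progs outs"
    and out: "pram_outputs_in prog P outs t w"
    and len: "\<forall>w\<in>set ws. length w \<le> P" "\<forall>w\<in>set outs. length w \<le> P" "length w \<le> P"
  defines "m \<equiv> length ws" and "l \<equiv> length progs"
  shows "\<exists>T'\<le>l * (2 * m + (5 * T + 4)) + 2 * l + 5 * t + 8.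
    pram_outputs_in (compose_prog m progs prog) P ws T' w"
proof -
  define A where "A = set (zip [1..<Suc m] ws)"
  let ?B = "A \<union> results m 0 outs"
  let ?c2 = "calls m 0 [1..<Suc m] progs"
  let ?c3 = "call m l (map (\<lambda>k. frame_arr m k 0) [0..<l]) prog"
  let ?c4 = "\<lambda>_. copy_array (frame_arr m l 0) 0"
  have l: "l = length outs" using outs by (simp add: l_def list_all2_lengthD)
  have A: "(b, v) \<in> A \<longleftrightarrow> (\<exists>k<m. b = Suc k \<and> v = ws ! k)" for b v
    by (force simp: A_def set_zip m_def simp del: upt_Suc)
  have avA: "avoids_frames m 0 A"
    using frame_arr_gt[of _ m] by (auto simp: avoids_frames_def A Suc_le_eq)
  have avB: "avoids_frames m l ?B"
    using avoids_frames_results[OF avA, of outs] by (simp add: l)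
  have c1: "triple P (length [Const 1 1, Pid 3]) (\<lambda>_. [Const 1 1, Pid 3])
      (\<lambda>s. s = init_state ws) (ready P m 0 A)"
  proof (rule triple_lockstep)
    fix s s' :: pram_state
    assume s: "s = init_state ws"
      and mem: "mem s' = fst (lockstep P [Const 1 1, Pid 3] (mem s, reg s))"
      and reg: "\<forall>i<P. reg s' i = snd (lockstep P [Const 1 1, Pid 3] (mem s, reg s)) i"
    have mem': "mem s' = mem (init_state ws)" using mem s by simp
    have reg': "\<forall>i<P. reg s' i = (\<lambda>_. 0)(1 := 1, 3 := i)"
      using reg s by (simp add: init_state_def)
    have "frame_reg j r \<noteq> 1" "frame_reg j r \<noteq> 3" "frame_reg j r \<noteq> Suc 0" for j r
      by (simp_all add: frame_reg_def)
    moreover have "\<not> frame_arr m j b \<le> m" for j b by (simp add: frame_arr_def)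
    ultimately show "ready P m 0 A s'"
      unfolding ready_def mem' using reg'
      by (auto simp: init_state_def A m_def[symmetric])
  qed simp
  have c2: "triple P (l * (2 * m + (5 * T + 4))) ?c2 (ready P m 0 A) (ready P m l ?B)"
  proof -
    have "\<forall>k<length ws. ([1..<Suc m] ! k, ws ! k) \<in> A" by (simp add: A m_def del: upt_Suc)
    then show ?thesis
      using calls_triple[OF P outs _ _ len(1) avA, of "[1..<Suc m]"]
      by (simp add: l_def m_def del: upt_Suc)
  qed
  have c3: "triple P (2 * l + (5 * t + 4)) ?c3 (ready P m l ?B)
      (ready P m (Suc l) (insert (frame_arr m l 0, w) ?B))"
  proof -
    have "\<forall>k<length outs. (map (\<lambda>k. frame_arr m k 0) [0..<l] ! k, outs ! k) \<in> ?B"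
    proof (intro allI impI UnI2)
      fix k assume "k < length outs"
      then show "(map (\<lambda>k. frame_arr m k 0) [0..<l] ! k, outs ! k) \<in> results m 0 outs"
        unfolding results_def in_set_zip by (intro exI[of _ k]) (simp add: l)
    qed
    then show ?thesis
      using call_triple[OF P out _ _ len(2) avB, of "map (\<lambda>k. frame_arr m k 0) [0..<l]"]
      by (simp add: l)
  qed
  have "triple P (length (?c4 0)) ?c4 (ready P m (Suc l) (insert (frame_arr m l 0, w) ?B))
      (\<lambda>s. mem s 0 = word_cells w)"
  proof (rule triple_lockstep)
    show "\<forall>I\<in>set (?c4 0). \<not> is_jump I" by (simp add: copy_array_def)
  next
    fix s s' :: pram_state
    assume s: "ready P m (Suc l) (insert (frame_arr m l 0, w) ?B) s"
      and mem: "mem s' = fst (lockstep P (?c4 0) (mem s, reg s))"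
    have pid: "\<forall>i<P. reg s i 3 = i" using s by (simp add: ready_def)
    have "mem s (frame_arr m l 0) = word_cells w" "mem s 0 = (\<lambda>_. 0)"
      using s by (auto simp: ready_def)
    from copy_word[of "mem s", OF this len(3)] show "mem s' 0 = word_cells w"
      unfolding mem lockstep_copy_array(1)[of P "reg s", OF pid] by simp
  qed
  then have c4: "triple P 2 ?c4 (ready P m (Suc l) (insert (frame_arr m l 0, w) ?B))
      (\<lambda>s. mem s 0 = word_cells w)"
    by simp
  let ?q = "compose_prog m progs prog"
  let ?c = "seq (\<lambda>_. [Const 1 1, Pid 3]) (seq ?c2 (seq ?c3 ?c4))"
  have q: "?q = ?c 0" by (simp add: compose_prog_def l_def Let_def)
  \<comment> \<open>The summands are the setup, the \<open>l\<close> inner calls, the outer call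
    with its \<open>l\<close> arguments, and the final copy.\<close>
  have "triple P (2 + (l * (2 * m + (5 * T + 4)) + (2 * l + (5 * t + 4) + 2))) ?c
      (\<lambda>s. s = init_state ws) (\<lambda>s. mem s 0 = word_cells w)"
    using triple_seq[OF c1 triple_seq[OF c2 triple_seq[OF c3 c4]]] by simp
  moreover have "placed ?q 0 (?c 0)" "\<forall>i<P. pc (init_state ws) i = 0"
    by (simp_all add: q init_state_def)
  ultimately obtain T' where T': "T' \<le> 2 + (l * (2 * m + (5 * T + 4)) + (2 * l + (5 * t + 4) + 2))"
    "\<forall>i<P. pc ((pram_step ?q P ^^ T') (init_state ws)) i = 0 + length (?c 0)"
    "mem ((pram_step ?q P ^^ T') (init_state ws)) 0 = word_cells w"
    unfolding triple_def by blast
  then have "pram_outputs_in ?q P ws T' w"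
    by (simp add: pram_outputs_in_def Let_def halted_def q)
  then show ?thesis using T'(1) by (intro exI[of _ T']) simp
qed

section \<open>Polynomial length of outputs\<close>

section \<open>Closure of NC under composition\<close>

text \<open>A cell that becomes nonzero is the target of a request, and each of the \<open>P\<close>
  processors makes at most one.\<close>

lemma card_par_write:
  assumes "finite {a. M b a \<noteq> 0}"
  shows "finite {a. par_write P w M b a \<noteq> 0} \<and>
    card {a. par_write P w M b a \<noteq> 0} \<le> card {a. M b a \<noteq> 0} + P"
proof -
  let ?W = "(\<lambda>i. fst (snd (the (w i)))) ` {..<P}"
  have "a \<in> {a. M b a \<noteq> 0} \<union> ?W" if "par_write P w M b a \<noteq> 0" for a
  proof (cases "\<exists>i<P. \<exists>v. w i = Some (b, a, v)")
    case True
    then obtain i v where "i < P" "w i = Some (b, a, v)" by blast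
    then have "a \<in> ?W" by (intro image_eqI[of _ _ i]) simp_all
    then show ?thesis by blast
  next
    case False
    then have "par_write P w M b a = M b a" by (intro par_write_other) blast
    then show ?thesis using that by simp
  qed
  then have sub: "{a. par_write P w M b a \<noteq> 0} \<subseteq> {a. M b a \<noteq> 0} \<union> ?W" by blast
  have "card ({a. M b a \<noteq> 0} \<union> ?W) \<le> card {a. M b a \<noteq> 0} + card ?W" by (rule card_Un_le)
  also have "\<dots> \<le> card {a. M b a \<noteq> 0} + P"
    using card_image_le[of "{..<P}" "\<lambda>i. fst (snd (the (w i)))"] by simp
  finally show ?thesis
    using sub assms by (meson card_mono finite_UnI finite_imageI finite_lessThan finite_subset order_trans)
qed

lemma card_pram_steps:
  assumes "mem s b = (\<lambda>_. 0)"
  shows "finite {a. mem ((pram_step q P ^^ t) s) b a \<noteq> 0} \<and>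
    card {a. mem ((pram_step q P ^^ t) s) b a \<noteq> 0} \<le> P * t"
proof (induction t)
  case (Suc t)
  let ?s = "(pram_step q P ^^ t) s"
  have "finite {a. mem (pram_step q P ?s) b a \<noteq> 0} \<and>
      card {a. mem (pram_step q P ?s) b a \<noteq> 0} \<le> card {a. mem ?s b a \<noteq> 0} + P"
    unfolding mem_pram_step by (rule card_par_write) (use Suc in blast)
  then show ?case using Suc by simp
qed (simp add: assms)

text \<open>Symbol codes are nonzero, so the length of the output is the number of nonzero cells in
  array 0, which starts empty.\<close>

lemma pram_output_length:
  assumes "pram_outputs_in prog P ws t w"
  shows "length w \<le> P * t"
proof -
  let ?s = "(pram_step prog P ^^ t) (init_state ws)"
  have "mem (init_state ws) 0 = (\<lambda>_. 0)" by (simp add: init_state_def)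
  then have "card {a. mem ?s 0 a \<noteq> 0} \<le> P * t" by (rule card_pram_steps[THEN conjunct2])
  moreover have "mem ?s 0 = word_cells w" using assms by (simp add: pram_outputs_in_def Let_def)
  moreover have "{a. word_cells w a \<noteq> 0} = {..<length w}" by (auto simp: word_cells_def)
  ultimately show ?thesis by simp
qed

section \<open>Estimates for logarithms\<close>

lemma log_ge_1: "1 \<le> log 2 (real n + 2)"
  by simp

lemma log_le_self:
  assumes "0 < x"
  shows "log 2 x \<le> x"
proof -
  \<comment> \<open>Halving the argument gives a linear bound of slope 1/2, which is at most
    \<open>ln 2\<close>; the same inequality at \<open>x\<close> would have slope 1.\<close>
  have "ln (x / 2) \<le> x / 2 - 1" using assms by (intro ln_le_minus_one) simp
  then have "ln x \<le> x / 2 - 1 + ln 2" using assms by (simp add: ln_div)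
  also have "\<dots> \<le> x * ln 2"
  proof -
    have "ln (1 / 2 :: real) \<le> 1 / 2 - 1" by (rule ln_le_minus_one) simp
    then have "1 / 2 \<le> ln (2 :: real)" by (simp add: ln_div)
    then have "0 \<le> x * (ln 2 - 1 / 2)" using assms by simp
    then show ?thesis using ln_2_less_1 by (simp add: algebra_simps)
  qed
  finally show ?thesis by (simp add: log_def divide_le_eq)
qed

lemma polylog_mono: "k \<le> k' \<Longrightarrow> polylog k n \<le> polylog k' n"
  unfolding polylog_def using log_ge_1[of n] by (intro power_increasing)

lemma polylog_ge_1: "1 \<le> polylog k n"
  unfolding polylog_def using log_ge_1[of n] by (rule one_le_power)

lemma polylog_le_power: "polylog k n \<le> real ((n + 2) ^ k)"
proof -
  have "log 2 (real n + 2) \<le> real n + 2" by (rule log_le_self) simp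
  then have "polylog k n \<le> (real n + 2) ^ k"
    unfolding polylog_def using log_ge_1[of n] by (intro power_mono) simp_all
  then show ?thesis by (simp add: add.commute)
qed

text \<open>The logarithm of \<open>(A + 2) * (n + 2) ^ e\<close> is a constant plus
  \<open>e\<close> times that of \<open>n + 2\<close>. Thus time measured in the size of
  intermediate results stays polylogarithmic in \<open>n\<close>, with the same exponent.\<close>

lemma polylog_of_polynomial:
  assumes "n' \<le> A * (n + 1) ^ e"
  shows "polylog k n' \<le> real ((A + 2 + e) ^ k) * polylog k n"
proof -
  let ?L = "log 2 (real n + 2)"
  have "n' + 2 \<le> A * (n + 1) ^ e + 2 * (n + 1) ^ e"
    using assms by (intro add_mono) simp_all
  also have "\<dots> = (A + 2) * (n + 1) ^ e" by (simp add: algebra_simps)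
  also have "\<dots> \<le> (A + 2) * (n + 2) ^ e" by (intro mult_left_mono power_mono) simp_all
  finally have "real (n' + 2) \<le> real ((A + 2) * (n + 2) ^ e)" by (rule of_nat_mono)
  then have "real n' + 2 \<le> (real A + 2) * (real n + 2) ^ e"
    by (simp only: of_nat_add of_nat_mult of_nat_power of_nat_numeral)
  then have "log 2 (real n' + 2) \<le> log 2 ((real A + 2) * (real n + 2) ^ e)"
    by simp
  also have "\<dots> = log 2 (real A + 2) + real e * ?L"
    by (simp add: log_mult log_nat_power)
  also have "\<dots> \<le> (real A + 2) + real e * ?L"
    using log_le_self[of "real A + 2"] by simp
  also have "\<dots> \<le> (real A + 2) * ?L + real e * ?L"
    using mult_left_mono[OF log_ge_1, of "real A + 2" n] by simp
  finally have "log 2 (real n' + 2) \<le> real (A + 2 + e) * ?L" by (simp add: algebra_simps)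
  then have "polylog k n' \<le> (real (A + 2 + e) * ?L) ^ k"
    unfolding polylog_def using log_ge_1[of n'] by (intro power_mono) simp_all
  then show ?thesis by (simp add: polylog_def power_mult_distrib)
qed

section \<open>Resource bounds of composed programs\<close>

abbreviation input_size :: "'a list list \<Rightarrow> nat" where
  "input_size ws \<equiv> sum_list (map length ws)"

text \<open>\<open>NC_computable\<close> with its witnesses exposed, together with the bound on
  output lengths that composition needs for the input size of the outer program.\<close>

definition NC_bound ::
  "instr list \<Rightarrow> nat \<Rightarrow> nat \<Rightarrow> ('x \<Rightarrow> 'a::finite list list) \<Rightarrow> ('x \<Rightarrow> 'a list) \<Rightarrow> bool" where
  "NC_bound prog C k inp f \<longleftrightarrow>
     (\<forall>x. length (f x) \<le> C * (input_size (inp x) + 1) ^ k \<and>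
        (\<forall>P \<ge> C * (input_size (inp x) + 1) ^ k. \<exists>t. real t \<le> real C * polylog k (input_size (inp x)) \<and>
           pram_outputs_in prog P (inp x) t (f x)))"

lemma power_bound_mono:
  fixes n :: nat
  assumes "C \<le> C'" "k \<le> k'"
  shows "C * (n + 1) ^ k \<le> C' * (n + 1) ^ k'"
  using assms by (intro mult_mono power_increasing) simp_all

lemma NC_bound_mono:
  assumes "NC_bound prog C k inp f" "C \<le> C'" "k \<le> k'"
  shows "NC_bound prog C' k' inp f"
  unfolding NC_bound_def
proof (intro allI conjI impI)
  fix x
  let ?n = "input_size (inp x)"
  note le = power_bound_mono[OF assms(2,3), of ?n]
  show "length (f x) \<le> C' * (?n + 1) ^ k'"
    using assms(1) le unfolding NC_bound_def by (meson order_trans)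
  fix P assume "C' * (?n + 1) ^ k' \<le> P"
  then obtain t where t: "real t \<le> real C * polylog k ?n" "pram_outputs_in prog P (inp x) t (f x)"
    using assms(1) le unfolding NC_bound_def by (meson order_trans)
  have "real C * polylog k ?n \<le> real C' * polylog k' ?n"
    using assms(2) polylog_mono[OF assms(3)] polylog_ge_1[of k ?n] by (intro mult_mono) simp_all
  then show "\<exists>t. real t \<le> real C' * polylog k' ?n \<and> pram_outputs_in prog P (inp x) t (f x)"
    using t by (meson order_trans)
qed

text \<open>Each processor writes at most one cell per step, so outputs are polynomially long.\<close>

lemma NC_computableE:
  assumes "NC_computable inp f"
  obtains prog C k where "NC_bound prog C k inp f"
proof -
  obtain prog C k where out: "\<And>x P. C * (input_size (inp x) + 1) ^ k \<le> P \<Longrightarrow>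
      \<exists>t. real t \<le> real C * polylog k (input_size (inp x)) \<and> pram_outputs_in prog P (inp x) t (f x)"
    using assms unfolding NC_computable_def Let_def by blast
  \<comment> \<open>The second summand comes from multiplying the least admissible number of
    processors by a time of at most \<open>C * (2 * (n + 1)) ^ k\<close>; the first keeps
    \<open>C'\<close> at least \<open>C\<close>.\<close>
  define C' where "C' = C + C * C * 2 ^ k"
  have "NC_bound prog C' (2 * k) inp f"
    unfolding NC_bound_def
  proof (intro allI conjI impI)
    fix x
    let ?n = "input_size (inp x)"
    have le: "C * (?n + 1) ^ k \<le> C' * (?n + 1) ^ (2 * k)"
      by (rule power_bound_mono) (simp_all add: C'_def)
    obtain t where t: "real t \<le> real C * polylog k ?n"
      "pram_outputs_in prog (C * (?n + 1) ^ k) (inp x) t (f x)"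
      using out by blast
    have "real t \<le> real C * real ((?n + 2) ^ k)"
      using t(1) mult_left_mono[OF polylog_le_power[of k ?n], of "real C"] by linarith
    then have "t \<le> C * (?n + 2) ^ k" by (metis of_nat_le_iff of_nat_mult)
    also have "\<dots> \<le> C * (2 * (?n + 1)) ^ k" by (intro mult_left_mono power_mono) simp_all
    finally have "t \<le> C * (2 * (?n + 1)) ^ k" .
    then have "C * (?n + 1) ^ k * t \<le> C * (?n + 1) ^ k * (C * (2 * (?n + 1)) ^ k)"
      by (rule mult_left_mono) simp
    also have "\<dots> = C * C * 2 ^ k * ((?n + 1) ^ k * (?n + 1) ^ k)"
      by (simp only: power_mult_distrib ac_simps)
    also have "\<dots> = C * C * 2 ^ k * (?n + 1) ^ (2 * k)"
      by (simp add: mult_2 power_add)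
    also have "\<dots> \<le> C' * (?n + 1) ^ (2 * k)"
      by (intro mult_right_mono) (simp_all add: C'_def)
    finally show "length (f x) \<le> C' * (?n + 1) ^ (2 * k)"
      using pram_output_length[OF t(2)] by linarith
    fix P assume "C' * (?n + 1) ^ (2 * k) \<le> P"
    then obtain t where t: "real t \<le> real C * polylog k ?n" "pram_outputs_in prog P (inp x) t (f x)"
      using out le by (meson order_trans)
    have "real C * polylog k ?n \<le> real C' * polylog (2 * k) ?n"
      using polylog_mono[of k "2 * k" ?n] polylog_ge_1[of k ?n]
      by (intro mult_mono) (simp_all add: C'_def)
    then show "\<exists>t. real t \<le> real C' * polylog (2 * k) ?n \<and> pram_outputs_in prog P (inp x) t (f x)"
      using t by (meson order_trans)
  qed
  then show ?thesis by (rule that)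
qed

lemma NC_computable_list:
  assumes "\<forall>f\<in>set fs. NC_computable inp f"
  shows "\<exists>progs C k. list_all2 (\<lambda>prog f. NC_bound prog C k inp f) progs fs"
  using assms
proof (induction fs)
  case (Cons f fs)
  then obtain progs C k where IH: "list_all2 (\<lambda>prog f. NC_bound prog C k inp f) progs fs" by auto
  obtain prog C' k' where f: "NC_bound prog C' k' inp f"
    using Cons.prems NC_computableE by (metis list.set_intros(1))
  let ?C = "max C C'" and ?k = "max k k'"
  have "list_all2 (\<lambda>prog f. NC_bound prog ?C ?k inp f) progs fs"
    using IH by (rule list_all2_mono) (erule NC_bound_mono, simp_all)
  moreover have "NC_bound prog ?C ?k inp f"
    using f by (rule NC_bound_mono) simp_all
  ultimately have "list_all2 (\<lambda>prog f. NC_bound prog ?C ?k inp f) (prog # progs) (f # fs)" by simp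
  then show ?case by blast
qed auto

lemma input_size_le: "\<forall>w\<in>set ws. length w \<le> B \<Longrightarrow> input_size ws \<le> length ws * B"
  by (induction ws) auto

lemma length_le_input_size: "w \<in> set ws \<Longrightarrow> length w \<le> input_size ws"
  by (induction ws) auto

text \<open>\<open>inp'\<close> presents \<open>h x\<close> as the tuple of inner results, so
  several inner functions are covered at once. The number \<open>m\<close> of input words is fixed
  because the program text depends on it.\<close>

theorem NC_computable_compose:
  fixes inp :: "'x \<Rightarrow> 'a::finite list list"
  assumes m: "\<And>x. length (inp x) = m"
    and fs: "\<forall>f\<in>set fs. NC_computable inp f"
    and g: "NC_computable inp' g" and h: "\<And>x. inp' (h x) = map (\<lambda>f. f x) fs"
  shows "NC_computable inp (\<lambda>x. g (h x))"
proof -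
  obtain progs C k where progs: "list_all2 (\<lambda>prog f. NC_bound prog C k inp f) progs fs"
    using NC_computable_list[OF fs] by blast
  obtain prog C' k' where prog: "NC_bound prog C' k' inp' g"
    using g by (rule NC_computableE)
  define l where "l = length fs"
  \<comment> \<open>The intermediate tuple has size at most \<open>A * (n + 1) ^ k\<close>;
    \<open>D\<close> and \<open>E\<close> are the resulting constants for processors and time of the
    outer program. \<open>K\<close> and \<open>e\<close> dominate all requirements.\<close>
  define A where "A = l * C"
  define D where "D = C' * (A + 1) ^ k'"
  define E where "E = C' * (A + 2 + k) ^ k'"
  define K where "K = 1 + C + D + (l * (2 * m + 4) + 5 * l * C + 2 * l + 5 * E + 8)"
  define e where "e = 1 + k + k' + k * k'"
  have bound: "\<exists>T. real T \<le> real K * polylog e n \<and> pram_outputs_in (compose_prog m progs prog) P (inp x) T (g (h x))"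
    if n: "n = input_size (inp x)" and P: "K * (n + 1) ^ e \<le> P" for n P x
  proof -
    let ?outs = "map (\<lambda>f. f x) fs"
    let ?n' = "input_size (inp' (h x))"
    have P_ge: "c * (n + 1) ^ d \<le> P" if "c \<le> K" "d \<le> e" for c d
      using power_bound_mono[OF that, of n] P by linarith
    have P1: "1 * (n + 1) ^ 1 \<le> P" by (rule P_ge) (simp_all add: K_def e_def)
    have P2: "C * (n + 1) ^ k \<le> P" by (rule P_ge) (simp_all add: K_def e_def)
    have P3: "D * (n + 1) ^ (k * k') \<le> P" by (rule P_ge) (simp_all add: K_def e_def)
    \<comment> \<open>A common bound for the inner running times, as a natural number.\<close>
    define T where "T = nat \<lfloor>real C * polylog k n\<rfloor>"
    have T: "real T \<le> real C * polylog k n"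
      unfolding T_def using polylog_ge_1[of k n] by simp
    have out1: "list_all2 (\<lambda>prog w. \<exists>t\<le>T. pram_outputs_in prog P (inp x) t w) progs ?outs"
      unfolding list_all2_map2 using progs
    proof (rule list_all2_mono)
      fix p f assume "NC_bound p C k inp f"
      then obtain t where t: "real t \<le> real C * polylog k n" "pram_outputs_in p P (inp x) t (f x)"
        using P2 unfolding NC_bound_def n by blast
      then have "t \<le> T" unfolding T_def by (simp add: le_nat_floor)
      then show "\<exists>t\<le>T. pram_outputs_in p P (inp x) t (f x)" using t(2) by blast
    qed
    have len1: "length w \<le> C * (n + 1) ^ k" if w: "w \<in> set ?outs" for w
    proof -
      obtain f where f: "f \<in> set fs" "w = f x" using w by auto
      then obtain p where "NC_bound p C k inp f"
        using progs by (metis in_set_conv_nth list_all2_conv_all_nth)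
      then show ?thesis unfolding NC_bound_def n f(2) by blast
    qed
    have "?n' \<le> length ?outs * (C * (n + 1) ^ k)"
      unfolding h using len1 by (intro input_size_le) blast
    then have n': "?n' \<le> A * (n + 1) ^ k" by (simp add: A_def l_def mult.assoc)
    then have "?n' + 1 \<le> A * (n + 1) ^ k + (n + 1) ^ k" by (intro add_mono) simp_all
    then have "?n' + 1 \<le> (A + 1) * (n + 1) ^ k" by simp
    then have "C' * (?n' + 1) ^ k' \<le> C' * ((A + 1) * (n + 1) ^ k) ^ k'"
      by (intro mult_left_mono power_mono) simp_all
    also have "\<dots> = D * (n + 1) ^ (k * k')"
      by (simp only: D_def power_mult_distrib power_mult mult.assoc)
    finally have P4: "C' * (?n' + 1) ^ k' \<le> P" using P3 by linarith
    obtain t where t: "real t \<le> real C' * polylog k' ?n'" "pram_outputs_in prog P ?outs t (g (h x))"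
      using prog P4 unfolding NC_bound_def h[symmetric] by blast
    have "length (g (h x)) \<le> P" using prog P4 unfolding NC_bound_def by (meson order_trans)
    moreover have "length w \<le> P" if "w \<in> set (inp x)" for w
      using length_le_input_size[OF that] P1 n by simp
    moreover have "length w \<le> P" if "w \<in> set ?outs" for w
      using len1[OF that] P2 by linarith
    moreover have "0 < P" using P1 by simp
    ultimately obtain T' where T':
      "T' \<le> length progs * (2 * length (inp x) + (5 * T + 4)) + 2 * length progs + 5 * t + 8"
      "pram_outputs_in (compose_prog (length (inp x)) progs prog) P (inp x) T' (g (h x))"
      using compose_prog_outputs[OF _ out1 t(2)] by blast
    have lp: "length progs = l" using progs by (simp add: l_def list_all2_lengthD)
    let ?R = "polylog e n"
    have R: "1 \<le> ?R" by (rule polylog_ge_1)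
    have "real T \<le> real C * ?R"
      using T mult_left_mono[OF polylog_mono[of k e n], of "real C"] by (simp add: e_def)
    moreover have "real t \<le> real E * ?R"
    proof -
      have "real t \<le> real C' * (real ((A + 2 + k) ^ k') * polylog k' n)"
        using t(1) mult_left_mono[OF polylog_of_polynomial[OF n', of k'], of "real C'"] by linarith
      also have "\<dots> = real E * polylog k' n" by (simp add: E_def)
      also have "\<dots> \<le> real E * ?R" by (intro mult_left_mono polylog_mono) (simp_all add: e_def)
      finally show ?thesis .
    qed
    moreover have "real T' \<le> real (l * (2 * m + 4) + 2 * l + 8) + real (5 * l) * real T + 5 * real t"
    proof -
      have "T' \<le> (l * (2 * m + 4) + 2 * l + 8) + 5 * l * T + 5 * t"
        using T'(1) by (simp add: lp m algebra_simps)
      then have "real T' \<le> real ((l * (2 * m + 4) + 2 * l + 8) + 5 * l * T + 5 * t)"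
        by (rule of_nat_mono)
      then show ?thesis by simp
    qed
    moreover have "real (l * (2 * m + 4) + 2 * l + 8) \<le> real (l * (2 * m + 4) + 2 * l + 8) * ?R"
      using mult_left_mono[OF R, of "real (l * (2 * m + 4) + 2 * l + 8)"] by simp
    moreover have "real (5 * l) * real T \<le> real (5 * l) * (real C * ?R)"
      using calculation(1) by (rule mult_left_mono) simp
    ultimately have "real T' \<le> real (l * (2 * m + 4) + 2 * l + 8) * ?R +
        real (5 * l) * (real C * ?R) + 5 * (real E * ?R)"
      by linarith
    also have "\<dots> = real (l * (2 * m + 4) + 2 * l + 8 + 5 * l * C + 5 * E) * ?R"
      by (simp add: algebra_simps)
    also have "\<dots> \<le> real K * ?R"
      using R by (intro mult_right_mono of_nat_mono) (simp_all add: K_def)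
    finally show ?thesis using T'(2) by (auto simp: m)
  qed
  then show ?thesis unfolding NC_computable_def Let_def by blast
qed

section \<open>Jump-free programs for basic functions\<close>

section \<open>Some NC functions\<close>

text \<open>The running time is the program length whatever the input, so only the value of
  \<open>lockstep\<close> has to be computed. The strict inequality ensures one more processor than
  there are input symbols.\<close>

lemma NC_computable_straight_line:
  assumes "\<forall>I\<in>set prog. \<not> is_jump I"
    and "\<And>x P. input_size (inp x) < P \<Longrightarrow>
      fst (lockstep P prog (mem (init_state (inp x)), \<lambda>i r. 0)) 0 = word_cells (f x)"
  shows "NC_computable inp f"
  unfolding NC_computable_def Let_def
proof (intro exI allI impI conjI)
  let ?C = "length prog + 1"
  fix x P assume P: "?C * (input_size (inp x) + 1) ^ 1 \<le> P"
  have "1 * (input_size (inp x) + 1) \<le> ?C * (input_size (inp x) + 1)" by (rule mult_right_mono) simp_all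
  then have lt: "input_size (inp x) < P" using P by simp
  have "real ?C * 1 \<le> real ?C * polylog 1 (input_size (inp x))"
    by (intro mult_left_mono polylog_ge_1) simp
  then show "real (length prog) \<le> real ?C * polylog 1 (input_size (inp x))"
    by (rule order_trans[rotated]) simp
  have "\<forall>i<P. pc (init_state (inp x)) i = 0" "\<forall>i<P. reg (init_state (inp x)) i = (\<lambda>r. 0)"
    by (simp_all add: init_state_def)
  from lockstep_run[OF placed_self this(1) assms(1) this(2)] assms(2)[OF lt]
  show "pram_outputs_in prog P (inp x) (length prog) (f x)"
    by (simp add: pram_outputs_in_def Let_def halted_def)
qed

lemma init_state_array:
  "k < length ws \<Longrightarrow> mem (init_state ws) (Suc k) = word_cells (ws ! k)"
  by (intro ext) (simp add: init_state_def)

lemma init_state_array_0: "mem (init_state ws) 0 = (\<lambda>_. 0)"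
  by (intro ext) (simp add: init_state_def)

lemma init_state_array_above: "length ws < b \<Longrightarrow> mem (init_state ws) b = (\<lambda>_. 0)"
  by (intro ext) (simp add: init_state_def)

lemma NC_computable_first:
  assumes "\<And>x. inp x = f x # rest x"
  shows "NC_computable inp f"
proof (rule NC_computable_straight_line[where prog = "[Pid 0, Load 1 1 0, Store 0 0 1]"])
  fix x and P :: nat
  assume "input_size (inp x) < P"
  then have "length (f x) < P" by (simp add: assms)
  moreover have "mem (init_state (inp x)) 1 = word_cells (f x)"
    using init_state_array[of 0 "inp x"] by (simp add: assms)
  ultimately show "fst (lockstep P [Pid 0, Load 1 1 0, Store 0 0 1]
      (mem (init_state (inp x)), \<lambda>i r. 0)) 0 = word_cells (f x)"
    by (auto simp: par_write_index init_state_array_0 word_cells_ge)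
qed simp

lemma NC_computable_Nil: "NC_computable inp (\<lambda>x. [])"
proof (rule NC_computable_straight_line[where prog = "[]"])
  show "fst (lockstep P [] (mem (init_state (inp x)), \<lambda>i r. 0)) 0 = word_cells []" for P x
    by (auto simp: init_state_array_0 word_cells_def)
qed simp

lemma NC_fun_Cons: "NC_fun (Cons a)"
  unfolding NC_fun_def
proof (rule NC_computable_straight_line)
  \<comment> \<open>Processor \<open>i\<close> moves symbol \<open>i - 1\<close> to cell
    \<open>i\<close>. Truncation makes processor 0 write to cell 0 as well, which the last
    instruction overwrites with the code of \<open>a\<close>; register 5 is still 0.\<close>
  let ?prog = "[Pid 0, Const 1 1, Sub 2 0 1, Load 3 1 2, Store 0 0 3,
    Const 4 (Suc (to_nat a)), Store 0 5 4]"
  show "\<forall>I\<in>set ?prog. \<not> is_jump I" by simp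
  fix x :: "'a list" and P
  assume "input_size [x] < P"
  then have P: "length x < P" by simp
  then have "\<exists>i. i < P" by auto
  have "fst (lockstep P ?prog (mem (init_state [x]), \<lambda>i r. 0)) 0 b = word_cells (a # x) b" for b
    using P init_state_array[of 0 "[x]"] \<open>\<exists>i. i < P\<close>
    by (cases b) (auto simp: par_write_index par_write_const init_state_array_0 word_cells_def)
  then show "fst (lockstep P ?prog (mem (init_state [x]), \<lambda>i r. 0)) 0 = word_cells (a # x)"
    by (intro ext)
qed

text \<open>Cells are shifted down by one; reading behind the word gives zero, which also settles
  the empty word.\<close>

lemma NC_computable_tl_first:
  assumes "\<And>x. inp x = f x # rest x"
  shows "NC_computable inp (\<lambda>x. tl (f x))"
proof (rule NC_computable_straight_line)
  let ?prog = "[Pid 0, Const 1 1, Add 2 0 1, Load 3 1 2, Store 0 0 3]"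
  show "\<forall>I\<in>set ?prog. \<not> is_jump I" by simp
  fix x and P :: nat
  assume "input_size (inp x) < P"
  then have "length (f x) < P" by (simp add: assms)
  moreover have "mem (init_state (inp x)) (Suc 0) = word_cells (f x)"
    using init_state_array[of 0 "inp x"] by (simp add: assms)
  ultimately have "fst (lockstep P ?prog (mem (init_state (inp x)), \<lambda>i r. 0)) 0 b = word_cells (tl (f x)) b" for b
    by (auto simp: par_write_index init_state_array_0 word_cells_def nth_tl)
  then show "fst (lockstep P ?prog (mem (init_state (inp x)), \<lambda>i r. 0)) 0 = word_cells (tl (f x))"
    by (intro ext)
qed

text \<open>Two truncated differences add up to the absolute difference, so the second
  \<open>Sub 3\<close> leaves 0 in register 3 exactly at a mismatch. Mismatches thus write
  \<open>K\<close> to cell 0 of array 4, matches to cell 1, which is never read. Register 8 is still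
  0 and addresses cell 0.\<close>

definition select_prog :: "nat \<Rightarrow> instr list" where
  "select_prog K = [Pid 0, Load 1 1 0, Load 2 2 0, Sub 3 1 2, Sub 4 2 1, Add 3 3 4, Const 5 1,
    Sub 3 5 3, Const 6 K, Store 4 3 6, Load 7 4 8, Load 9 3 0, Sub 9 9 7, Store 0 0 9]"

lemma word_cells_eqD:
  assumes "word_cells u = word_cells v"
  shows "u = v"
proof -
  have "{a. word_cells w a \<noteq> 0} = {..<length w}" for w :: "'a list"
    by (auto simp: word_cells_def)
  then have "{..<length u} = {..<length v}" using assms by metis
  then have "length u = length v" by simp
  moreover have "u ! i = v ! i" if "i < length u" for i
    using fun_cong[OF assms, of i] that calculation by (simp add: word_cells_def)
  ultimately show ?thesis by (rule nth_equalityI)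
qed

text \<open>
  Every mismatch of the first two words writes \<open>K\<close> into one cell, which is afterwards subtracted
  (with truncation) from each symbol of the third word; \<open>K\<close> bounds all symbol codes.
\<close>

lemma NC_computable_select:
  "NC_computable (\<lambda>(u, v, w). [u, v, w]) (\<lambda>(u, v, w). if u = v then w else [] :: 'a::finite list)"
proof (rule NC_computable_straight_line)
  \<comment> \<open>\<open>Suc\<close> because \<open>word_cells\<close> stores \<open>Suc\<close>
    of the numbering.\<close>
  define K where "K = Suc (Max (range (to_nat :: 'a \<Rightarrow> nat)))"
  have K: "word_cells w i \<le> K" for w :: "'a list" and i
    by (simp add: word_cells_def K_def)
  show "\<forall>I\<in>set (select_prog K). \<not> is_jump I" by (simp add: select_prog_def)
  fix x :: "'a list \<times> 'a list \<times> 'a list" and P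
  obtain u v w where x: "x = (u, v, w)" by (cases x)
  assume "input_size (case x of (u, v, w) \<Rightarrow> [u, v, w]) < P"
  then have P: "length u < P" "length v < P" "length w < P" by (auto simp: x)
  let ?s = "mem (init_state [u, v, w])"
  have arr: "?s (Suc 0) = word_cells u" "?s 2 = word_cells v" "?s 3 = word_cells w"
    "?s 4 = (\<lambda>_. 0)" "?s 0 = (\<lambda>_. 0)"
    using init_state_array[of 0 "[u, v, w]"] init_state_array[of 1 "[u, v, w]"]
      init_state_array[of 2 "[u, v, w]"] init_state_array_above[of "[u, v, w]" 4]
      init_state_array_0[of "[u, v, w]"]
    by (simp_all add: eval_nat_numeral)
  let ?d = "\<lambda>i. Suc 0 - (word_cells u i - word_cells v i + (word_cells v i - word_cells u i))"
  let ?f = "if \<exists>i<P. ?d i = 0 then K else 0"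
  have f: "?f = (if u = v then 0 else K)"
  proof (cases "u = v")
    case False
    then have "\<exists>i. word_cells u i \<noteq> word_cells v i" using word_cells_eqD by blast
    then obtain i where i: "word_cells u i \<noteq> word_cells v i" by blast
    \<comment> \<open>Behind both words the cells are zero, so some processor is there to see the
      mismatch.\<close>
    then have "i < P" using P by (metis linorder_not_le order_trans less_imp_le word_cells_ge)
    moreover have "?d i = 0" using i by linarith
    ultimately show ?thesis using False by auto
  qed simp
  have "fst (lockstep P (select_prog K) (?s, \<lambda>i r. 0)) 0 =
      (\<lambda>i. if i < P then word_cells w i - ?f else 0)"
    by (intro ext) (simp add: select_prog_def par_write_index par_write_const arr cong: if_cong)
  also have "\<dots> = word_cells (if u = v then w else [])"
    unfolding f using K P by (auto simp: word_cells_ge word_cells_def[of "[]"] fun_eq_iff)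
  finally show "fst (lockstep P (select_prog K) (mem (init_state (case x of (u, v, w) \<Rightarrow> [u, v, w])),
      \<lambda>i r. 0)) 0 = word_cells (case x of (u, v, w) \<Rightarrow> if u = v then w else [])"
    by (simp add: x)
qed

lemma NC_computable_comp1:
  fixes inp :: "'x \<Rightarrow> 'a::finite list list"
  assumes "\<And>x. length (inp x) = m" "NC_computable inp f" "NC_fun g"
  shows "NC_computable inp (\<lambda>x. g (f x))"
  using assms(2,3) unfolding NC_fun_def
  by (intro NC_computable_compose[where fs = "[f]" and h = f and g = g, OF assms(1)]) simp_all

lemma NC_computable_comp2:
  fixes inp :: "'x \<Rightarrow> 'a::finite list list"
  assumes "\<And>x. length (inp x) = m" "NC_computable inp f1" "NC_computable inp f2" "NC_fun2 g"
  shows "NC_computable inp (\<lambda>x. g (f1 x) (f2 x))"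
  using NC_computable_compose[where fs = "[f1, f2]" and h = "\<lambda>x. (f1 x, f2 x)", OF assms(1) _
    assms(4)[unfolded NC_fun2_def]] assms(2,3) by simp

lemma NC_computable_if_eq:
  fixes inp :: "'x \<Rightarrow> 'a::finite list list"
  assumes "\<And>x. length (inp x) = m" "NC_computable inp f1" "NC_computable inp f2"
    "NC_computable inp f3"
  shows "NC_computable inp (\<lambda>x. if f1 x = f2 x then f3 x else [])"
  using NC_computable_compose[where fs = "[f1, f2, f3]" and h = "\<lambda>x. (f1 x, f2 x, f3 x)",
    OF assms(1) _ NC_computable_select] assms(2-4) by simp

section \<open>From fcr-reductions to many-one reductions and back\<close>

section \<open>Transitivity\<close>

text \<open>The only word of \<open>L\<close> that can yield the pair is \<open>\<rho> D Q\<close>,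
  so the existential quantifier becomes a condition on one computable word.\<close>

lemma pair_language_iff:
  assumes "cr_factorization L (\<pi>1, \<pi>2, \<rho>, c)"
  shows "(D, Q) \<in> pair_language L (\<pi>1, \<pi>2, \<rho>, c) \<longleftrightarrow>
    \<rho> D Q \<in> L \<and> \<pi>1 (\<rho> D Q) = D \<and> \<pi>2 (\<rho> D Q) = Q"
proof -
  have "\<forall>x\<in>L. \<rho> (\<pi>1 x) (\<pi>2 x) = x" using assms by (simp add: cr_factorization_def)
  then show ?thesis by (simp add: pair_language_def) metis
qed

text \<open>
  Here \<open>y\<close> is the candidate word of the second language; the equations say that the restoring
  functions invert the factorizations at \<open>x\<close> and at \<open>y x\<close>.
\<close>

lemma NC_fcr_reducible_many_one:
  fixes L1 L2 :: "'a::finite list set"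
  assumes "L1 \<le>\<^sub>f\<^sub>c\<^sub>r L2"
  obtains y u1 u2 u3 v2 v3 :: "'a list \<Rightarrow> 'a list"
  where "NC_fun y" "NC_fun u1" "NC_fun u2" "NC_fun u3" "NC_fun v2" "NC_fun v3"
    and "\<And>x. x \<in> L1 \<longleftrightarrow> u1 x = x \<and> u2 x = v2 x \<and> u3 x = v3 x \<and> y x \<in> L2"
proof -
  obtain F1 F2 \<alpha> \<beta> where F: "cr_factorization L1 F1" "cr_factorization L2 F2"
      "NC_fun \<alpha>" "NC_fun \<beta>"
      "\<And>D Q. (D, Q) \<in> pair_language L1 F1 \<longleftrightarrow> (\<alpha> D, \<beta> Q) \<in> pair_language L2 F2"
    using assms unfolding NC_fcr_reducible_def by blast
  obtain \<pi>1 \<pi>2 \<rho>1 c1 where eq1: "F1 = (\<pi>1, \<pi>2, \<rho>1, c1)" by (cases F1)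
  obtain \<tau>1 \<tau>2 \<rho>2 c2 where eq2: "F2 = (\<tau>1, \<tau>2, \<rho>2, c2)" by (cases F2)
  note F = F[unfolded eq1 eq2]
  have F1: "cr_factorization L1 (\<pi>1, \<pi>2, \<rho>1, c1)"
    and F2: "cr_factorization L2 (\<tau>1, \<tau>2, \<rho>2, c2)" and NC: "NC_fun \<alpha>" "NC_fun \<beta>"
    by (fact F)+
  let ?u1 = "\<lambda>x. \<rho>1 (\<pi>1 x) (\<pi>2 x)" and ?v2 = "\<lambda>x. \<alpha> (\<pi>1 x)" and ?v3 = "\<lambda>x. \<beta> (\<pi>2 x)"
  let ?y = "\<lambda>x. \<rho>2 (\<alpha> (\<pi>1 x)) (\<beta> (\<pi>2 x))"
  let ?u2 = "\<lambda>x. \<tau>1 (?y x)" and ?u3 = "\<lambda>x. \<tau>2 (?y x)"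
  have NC1: "NC_fun \<pi>1" "NC_fun \<pi>2" "NC_fun2 \<rho>1" and \<rho>1: "\<And>x. x \<in> L1 \<Longrightarrow> ?u1 x = x"
    using F1 by (auto simp: cr_factorization_def)
  have NC2: "NC_fun \<tau>1" "NC_fun \<tau>2" "NC_fun2 \<rho>2"
    using F2 by (auto simp: cr_factorization_def)
  have comp1: "NC_fun (\<lambda>x. g (f x))" if "NC_fun f" "NC_fun g" for f g :: "'a list \<Rightarrow> 'a list"
    using that NC_computable_comp1[of "\<lambda>x. [x]" 1 f g] by (simp add: NC_fun_def)
  have comp2: "NC_fun (\<lambda>x. g (f1 x) (f2 x))" if "NC_fun f1" "NC_fun f2" "NC_fun2 g"
    for f1 f2 :: "'a list \<Rightarrow> 'a list" and g
    using that NC_computable_comp2[of "\<lambda>x. [x]" 1 f1 f2 g] by (simp add: NC_fun_def)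
  note v2 = comp1[OF NC1(1) NC(1)] and v3 = comp1[OF NC1(2) NC(2)]
  note y = comp2[OF v2 v3 NC2(3)]
  have "x \<in> L1 \<longleftrightarrow> ?u1 x = x \<and> ?u2 x = ?v2 x \<and> ?u3 x = ?v3 x \<and> ?y x \<in> L2" for x
  proof -
    \<comment> \<open>Without the test \<open>?u1 x = x\<close>, a word outside \<open>L1\<close>
      might share its pair with a word of \<open>L1\<close>.\<close>
    have "x \<in> L1 \<longleftrightarrow> ?u1 x = x \<and> (\<pi>1 x, \<pi>2 x) \<in> pair_language L1 (\<pi>1, \<pi>2, \<rho>1, c1)"
      using \<rho>1 unfolding pair_language_iff[OF F1] by auto
    then show ?thesis unfolding F(5) pair_language_iff[OF F2] by blast
  qed
  then show ?thesis
    by (rule that[OF y comp2[OF NC1] comp1[OF y NC2(1)] comp1[OF y NC2(2)] v2 v3])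
qed

theorem theorem1:
  fixes L1 L2 L3 :: "'a::finite list set"
  assumes "L1 \<le>\<^sub>f\<^sub>c\<^sub>r L2" and "L2 \<le>\<^sub>f\<^sub>c\<^sub>r L3"
  shows "L1 \<le>\<^sub>f\<^sub>c\<^sub>r L3"
proof -
  obtain y u1 u2 u3 v2 v3 :: "'a list \<Rightarrow> 'a list"
    where NC1: "NC_fun y" "NC_fun u1" "NC_fun u2" "NC_fun u3" "NC_fun v2" "NC_fun v3"
      and L1: "\<And>x. x \<in> L1 \<longleftrightarrow> u1 x = x \<and> u2 x = v2 x \<and> u3 x = v3 x \<and> y x \<in> L2"
    using NC_fcr_reducible_many_one[OF assms(1)] by blast
  obtain z w1 w2 w3 r2 r3 :: "'a list \<Rightarrow> 'a list"
    where NC2: "NC_fun z" "NC_fun w1" "NC_fun w2" "NC_fun w3" "NC_fun r2" "NC_fun r3"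
      and L2: "\<And>x. x \<in> L2 \<longleftrightarrow> w1 x = x \<and> w2 x = r2 x \<and> w3 x = r3 x \<and> z x \<in> L3"
    using NC_fcr_reducible_many_one[OF assms(2)] by blast
  define a :: 'a where "a = undefined"
  \<comment> \<open>Three tests concern \<open>x\<close>, three its candidate \<open>y x\<close>.
    Rejection gives \<open>[]\<close>, which is not in the range of \<open>Cons a\<close>.\<close>
  define \<alpha> where "\<alpha> = (\<lambda>x. if u1 x = x then if u2 x = v2 x then if u3 x = v3 x
    then if w1 (y x) = y x then if w2 (y x) = r2 (y x) then if w3 (y x) = r3 (y x)
    then a # z (y x) else [] else [] else [] else [] else [] else [])"
  have comp: "NC_fun (\<lambda>x. g (f x))" if "NC_fun f" "NC_fun g" for f g :: "'a list \<Rightarrow> 'a list"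
    using that NC_computable_comp1[of "\<lambda>x. [x]" 1 f g] by (simp add: NC_fun_def)
  have if_eq: "NC_fun (\<lambda>x. if f1 x = f2 x then f3 x else [])"
    if "NC_fun f1" "NC_fun f2" "NC_fun f3" for f1 f2 f3 :: "'a list \<Rightarrow> 'a list"
    using that NC_computable_if_eq[of "\<lambda>x. [x]" 1 f1 f2 f3] by (simp add: NC_fun_def)
  have id: "NC_fun (\<lambda>x :: 'a list. x)"
    unfolding NC_fun_def by (rule NC_computable_first[where rest = "\<lambda>_. []"]) simp
  have nil: "NC_fun (\<lambda>x :: 'a list. [])"
    unfolding NC_fun_def by (rule NC_computable_Nil)
  have \<alpha>: "NC_fun \<alpha>"
    unfolding \<alpha>_def
    by (intro if_eq NC1 id comp[OF NC1(1) NC2(2)] comp[OF NC1(1) NC2(3)] comp[OF NC1(1) NC2(4)]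
      comp[OF NC1(1) NC2(5)] comp[OF NC1(1) NC2(6)]
      comp[OF comp[OF NC1(1) NC2(1)] NC_fun_Cons])
  \<comment> \<open>Second parts are empty, so the polylogarithmic bound is trivial and the identity
    serves as the map on them; the redundancy 1 in \<open>F3\<close> pays for
    \<open>a\<close>.\<close>
  define F1 :: "'a factorization" where "F1 = (\<lambda>x. x, \<lambda>x. [], \<lambda>D Q. D, 0)"
  define F3 :: "'a factorization" where "F3 = (Cons a, \<lambda>x. [], \<lambda>D Q. tl D, 1)"
  have fst2: "NC_fun2 (\<lambda>D Q :: 'a list. D)"
    unfolding NC_fun2_def by (rule NC_computable_first[where rest = "\<lambda>(D, Q). [Q]"]) auto
  have tl2: "NC_fun2 (\<lambda>D Q :: 'a list. tl D)"
    unfolding NC_fun2_def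
    using NC_computable_tl_first[where inp = "\<lambda>(D, Q). [D, Q]" and f = fst and rest = "\<lambda>(D, Q). [Q]"]
    by (simp add: case_prod_beta')
  have "cr_factorization L1 F1"
    using id nil fst2 by (simp add: cr_factorization_def F1_def exI[of _ 0])
  moreover have "cr_factorization L3 F3"
    using nil tl2 NC_fun_Cons[of a] by (simp add: cr_factorization_def F3_def exI[of _ 0])
  moreover have "(D, Q) \<in> pair_language L1 F1 \<longleftrightarrow> (\<alpha> D, Q) \<in> pair_language L3 F3" for D Q
  proof -
    have "D \<in> L1 \<longleftrightarrow> (\<exists>x\<in>L3. \<alpha> D = a # x)"
      unfolding L1 L2 \<alpha>_def by auto
    then show ?thesis by (auto simp: pair_language_def F1_def F3_def)
  qed
  ultimately show ?thesis
    unfolding NC_fcr_reducible_def using \<alpha> id by blast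
qed

end
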